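(* Consider the distributed primal–dual algorithm described in the context, run with arbitrary initial values $x_{i,0},\lambda_{i,0}\in\mathbb{R}^m$, $i=1,\dots,n$. Assume: (i) $\Omega_o=\bigcap_{i=1}^n\Omega_i$ has at least one relative interior point; (ii) there is $L_f>0$ such that $\|\nabla f_i(x)-\nabla f_i(y)\|\le L_f\|x-y\|$ for all $x,y\in\Omega_i$ and all $i$; (iii) the adjacency matrices $\{\mathcal{A}_k\}_{k\ge0}$ are i.i.d. with mean $\bar{\mathcal{A}}=E[\mathcal{A}_k]$; the graph generated by $\bar{\mathcal{A}}$ (edge $(j,i)$ iff $\bar a_{ij}>0$) is undirected ($\bar{\mathcal{A}}$ symmetric) and connected; there is $\eta>0$ with $E[a_{ij,k}^2]=\sigma_{ij}\le\eta^2$ for all $i,j$; and $\mathcal{L}_k$ is independent of $\mathcal{F}_{k-1}$; (iv) for all $i,j$: $E[\omega_{ij,k}\mid\mathcal{F}'_{k-1}]=0$, $E[\|\omega_{ij,k}\|^2\mid\mathcal{F}'_{k-1}]\le\mu^2$; $E[\zeta_{ij,k}\mid\mathcal{F}'_{k-1}]=0$, $E[\|\zeta_{ij,k}\|^2\mid\mathcal{F}'_{k-1}]\le\mu^2$; $E[v_{i,k}\mid\mathcal{F}'_{k-1}]=0$, $E[\|v_{i,k}\|^2\mid\mathcal{F}'_{k-1}]\le c_v(1+\|x_{i,k}\|^2)$, for constants $\mu,c_v>0$; (v) $\gamma_k>0$, $\sum_k\gamma_k=\infty$, $\sum_k\gamma_k^2<\infty$. Let $(X^*,\Lambda^* )$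 be a saddle point of $\Phi$ in $\Omega\times\mathbb{R}^{mn}$. Then $\|X_k-X^*\|^2+\|\Lambda_k-\Lambda^*\|^2$ converges almost surely.
   Context: Setting: $n$ agents, $\mathcal{V}=\{1,\dots,n\}$, dimension $m\ge1$. For each $i$, $\Omega_i\subset\mathbb{R}^m$ is a nonempty closed convex set and $f_i:\mathbb{R}^m\to\mathbb{R}$ is convex and differentiable on $\Omega_i$; the problem is to minimize $f(x)=\sum_i f_i(x)$ over $\Omega_o=\bigcap_i\Omega_i$, and it is assumed to have at least one finite solution. $\Omega=\prod_{i=1}^n\Omega_i\subset\mathbb{R}^{mn}$, and $P_{\Omega_i}$ is the Euclidean projection onto $\Omega_i$. Random graphs: at each time $k\ge0$ there is a random nonnegative adjacency matrix $\mathcal{A}_k=[a_{ij,k}]$ with $a_{ii,k}=0$; its Laplacian is $\mathcal{L}_k=\mathcal{D}_k-\mathcal{A}_k$ with $\mathcal{D}_k=\mathrm{diag}(\sum_j a_{1j,k},\dots,\sum_j a_{nj,k})$; $\mathcal{N}_{i,k}=\{j: a_{ij,k}>0\}$. $\bar{\mathcal{L}}=E[\mathcal{L}_k]$. Algorithm: agent $i$ receives from $j\in\mathcal{N}_{i,k}$ the noisy values $x_{ij,k}=x_{j,k}+\omega_{ij,k}$, $\lambda_{ij,k}=\lambda_{j,k}+\zeta_{ij,k}$, and observes $g_{i,k}=\nabla f_i(x_{i,k})+v_{i,k}$; it updates $x_{i,k+1}=P_{\Omega_i}\big(x_{i,k}-\gamma_k g_{i,k}-\gamma_k\sum_{j\in\mathcal{N}_{i,k}}a_{ij,k}(\lambda_{i,k}-\lambda_{ij,k})-\gamma_k\sum_{j\in\mathcal{N}_{i,k}}a_{ij,k}(x_{i,k}-x_{ij,k})\big)$,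 $\lambda_{i,k+1}=\lambda_{i,k}+\gamma_k\sum_{j\in\mathcal{N}_{i,k}}a_{ij,k}(x_{i,k}-x_{ij,k})$, with step sizes $\gamma_k$. $X_k=(x_{1,k}^T,\dots,x_{n,k}^T)^T$, $\Lambda_k=(\lambda_{1,k}^T,\dots,\lambda_{n,k}^T)^T$. $\sigma$-algebras: $\mathcal{F}_k=\sigma\{X_0,\Lambda_0,\omega_{ij,t},\zeta_{ij,t},v_{i,t},\mathcal{L}_t:0\le t\le k,\ 1\le i,j\le n\}$ and $\mathcal{F}'_k=\sigma\{\mathcal{L}_{k+1},\mathcal{F}_k\}$. Lagrangian: $\Phi(X,\Lambda)=\sum_{i=1}^n f_i(x_i)+\Lambda^T(\bar{\mathcal{L}}\otimes\mathbf{I}_m)X$ for $X=(x_1^T,\dots,x_n^T)^T$, $\Lambda\in\mathbb{R}^{mn}$. $(X^*,\Lambda^* )\in\Omega\times\mathbb{R}^{mn}$ is a saddle point if $\Phi(X^*,\Lambda)\le\Phi(X^*,\Lambda^* )\le\Phi(X,\Lambda^* )$ for all $X\in\Omega$, $\Lambda\in\mathbb{R}^{mn}$. *)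

theory Defs
  imports "HOL-Analysis.Analysis" "HOL-Probability.Probability"
begin

text \<open>Agents are indexed by a finite type 'n; R^m is an abstract euclidean space 'a.
  Random adjacency matrices are of type real^'n^'n (entry a $ i $ j = a_ij).\<close>

definition laplacian :: "real^'n::finite^'n \<Rightarrow> real^'n^'n" where
  "laplacian A = (\<chi> i j. (if i = j then (\<Sum>l\<in>UNIV. A $ i $ l) else 0) - A $ i $ j)"

text \<open>Mean matrices (expectations entrywise).\<close>
definition mean_mat :: "'b measure \<Rightarrow> ('b \<Rightarrow> real^'n::finite^'n) \<Rightarrow> real^'n^'n" where
  "mean_mat M A = (\<chi> i j. integral\<^sup>L M (\<lambda>\<omega>. A \<omega> $ i $ j))"

text \<open>Undirected connectivity of the graph generated by a matrix (edge (j,i) iff a_ij > 0).\<close>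
definition graph_connected :: "real^'n::finite^'n \<Rightarrow> bool" where
  "graph_connected A \<longleftrightarrow> (\<forall>i j. (i, j) \<in> {(p, q). A $ p $ q > 0}\<^sup>*)"

text \<open>The information sigma-algebra generated by the adjacency matrices A_t, t \<in> K, and the
  communication/gradient noises at times t \<in> N (initial values are deterministic).\<close>
definition info_sigma ::
  "'b measure \<Rightarrow> (nat \<Rightarrow> 'b \<Rightarrow> real^'n::finite^'n)
   \<Rightarrow> (nat \<Rightarrow> 'n \<Rightarrow> 'n \<Rightarrow> 'b \<Rightarrow> 'a::euclidean_space) \<Rightarrow> (nat \<Rightarrow> 'n \<Rightarrow> 'n \<Rightarrow> 'b \<Rightarrow> 'a)
   \<Rightarrow> (nat \<Rightarrow> 'n \<Rightarrow> 'b \<Rightarrow> 'a) \<Rightarrow> nat set \<Rightarrow> nat set \<Rightarrow> 'b measure" where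
  "info_sigma M A wx wl v K N = sigma (space M)
     ({A t -` B \<inter> space M | t B. t \<in> K \<and> B \<in> sets borel}
      \<union> {wx t i j -` B \<inter> space M | t i j B. t \<in> N \<and> B \<in> sets borel}
      \<union> {wl t i j -` B \<inter> space M | t i j B. t \<in> N \<and> B \<in> sets borel}
      \<union> {v t i -` B \<inter> space M | t i B. t \<in> N \<and> B \<in> sets borel})"

text \<open>Lagrangian \<Phi>(X,\<Lambda>) = \<Sum>_i f_i(x_i) + \<Lambda>^T (L \<otimes> I_m) X.\<close>
definition lagrangian :: "('n::finite \<Rightarrow> 'a::euclidean_space \<Rightarrow> real) \<Rightarrow> real^'n^'n
    \<Rightarrow> ('n \<Rightarrow> 'a) \<Rightarrow> ('n \<Rightarrow> 'a) \<Rightarrow> real" where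
  "lagrangian f L X \<Lambda> = (\<Sum>i\<in>UNIV. f i (X i)) + (\<Sum>i\<in>UNIV. \<Sum>j\<in>UNIV. L $ i $ j * (\<Lambda> i \<bullet> X j))"

definition saddle_point :: "('n::finite \<Rightarrow> 'a::euclidean_space \<Rightarrow> real) \<Rightarrow> real^'n^'n
    \<Rightarrow> ('n \<Rightarrow> 'a set) \<Rightarrow> ('n \<Rightarrow> 'a) \<Rightarrow> ('n \<Rightarrow> 'a) \<Rightarrow> bool" where
  "saddle_point f L \<Omega> Xs \<Lambda>s \<longleftrightarrow> (\<forall>i. Xs i \<in> \<Omega> i)
     \<and> (\<forall>\<Lambda>. lagrangian f L Xs \<Lambda> \<le> lagrangian f L Xs \<Lambda>s)
     \<and> (\<forall>X. (\<forall>i. X i \<in> \<Omega> i) \<longrightarrow> lagrangian f L Xs \<Lambda>s \<le> lagrangian f L X \<Lambda>s)"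

end

theory Submission
  imports Defs
begin

text \<open>Let \<open>V\<^sub>k = \<parallel>X\<^sub>k - X\<^sup>*\<parallel>\<^sup>2 + \<parallel>\<Lambda>\<^sub>k - \<Lambda>\<^sup>*\<parallel>\<^sup>2\<close>. Since the projections are nonexpansive and fix \<open>X\<^sup>*\<close>,
  \<open>V\<^sub>k\<^sub>+\<^sub>1\<close> is at most \<open>V\<^sub>k\<close> minus \<open>2 \<gamma>\<^sub>k\<close> times a drift plus \<open>\<gamma>\<^sub>k\<^sup>2\<close> times the squared step direction.
  Given the past, the noises average out and the random graph is replaced by its mean, and the mean drift is
  nonnegative by convexity, the symmetry of the mean Laplacian and the saddle point inequalities; the squared
  directions are bounded in the mean by a multiple of \<open>1 + V\<^sub>k\<close>. Hence \<open>V\<close> is a nonnegative supermartingale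
  up to summable errors, and Doob's upcrossing argument gives almost sure convergence.
  A conditional inequality is read as an inequality between integrals over every set of the past.\<close>

text \<open>The random weights and noises are controlled only through second moments, and
  \<open>V k\<close> is not known to be integrable before the recursion has been bounded. The second
  moment bounds are therefore proved with extended nonnegative integrals, with constants uniform in
  time; integrability of \<open>V k\<close> follows by induction, and only then are real integrals
  compared. Each step involves two sigma-algebras: the noise at time \<open>k\<close> is centred
  given the past together with \<open>A k\<close>, whereas \<open>A k\<close> is independent of the
  past alone. A product of a weight and a noise is therefore treated in this order, first the noise
  and then the weight. Testing on sets of the past is exactly what the upcrossing argument consumes:
  the event that the trader holds at time \<open>k\<close> is such a set. Gradient, Lipschitz and
  convexity hypotheses speak only of points of \<open>\<Omega> i\<close>, while an initial value may
  lie anywhere. Time 0 is thus a case apart wherever these hypotheses enter.\<close>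

subsection \<open>Almost supermartingales\<close>

text \<open>State of the trader who buys when \<open>y\<close> is at most \<open>a\<close> and sells once it reaches \<open>b\<close>.\<close>
primrec holding :: "real \<Rightarrow> real \<Rightarrow> (nat \<Rightarrow> real) \<Rightarrow> nat \<Rightarrow> bool" where
  "holding a b y 0 \<longleftrightarrow> y 0 \<le> a"
| "holding a b y (Suc n) \<longleftrightarrow> (if holding a b y n then y (Suc n) < b else y (Suc n) \<le> a)"

primrec upcrossings :: "real \<Rightarrow> real \<Rightarrow> (nat \<Rightarrow> real) \<Rightarrow> nat \<Rightarrow> nat" where
  "upcrossings a b y 0 = 0"
| "upcrossings a b y (Suc n) =
    upcrossings a b y n + (if holding a b y n \<and> b \<le> y (Suc n) then 1 else 0)"

text \<open>The right side is the trader's total gain. A completed cycle earns at least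
  \<open>b - a\<close>, and an open position, bought at a price of at most \<open>a\<close>, is
  worth at least \<open>y n - a\<close>. Keeping this possibly negative term makes the induction
  close.\<close>

lemma upcrossings_gain:
  assumes "a < b"
  shows "(b - a) * real (upcrossings a b y n) + (if holding a b y n then y n - a else 0)
    \<le> (\<Sum>k<n. of_bool (holding a b y k) * (y (Suc k) - y k))"
proof (induction n)
  case (Suc n)
  show ?case
    using Suc assms by (cases "holding a b y n"; cases "holding a b y (Suc n)") (auto simp: algebra_simps)
qed simp

text \<open>A bounded monotone count is eventually constant. From then on no sale occurs, so either
  the trader holds forever and \<open>y\<close> stays below \<open>b\<close>, or never buys again
  and \<open>y\<close> stays above \<open>a\<close>.\<close>

lemma bounded_upcrossings_no_oscillation:
  assumes "a < b" and bound: "\<And>n. upcrossings a b y n \<le> C"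
    and low: "\<exists>\<^sub>F n in sequentially. y n \<le> a" and high: "\<exists>\<^sub>F n in sequentially. b \<le> y n"
  shows False
proof -
  let ?h = "holding a b y"
  have "mono (upcrossings a b y)"
    by (rule incseq_SucI) simp
  have fin: "finite (range (upcrossings a b y))"
    using bound by (auto intro: finite_subset[of _ "{..C}"])
  have "Max (range (upcrossings a b y)) \<in> range (upcrossings a b y)"
    by (rule Max_in[OF fin]) simp
  then obtain N where "upcrossings a b y N = Max (range (upcrossings a b y))"
    by fastforce
  then have N: "upcrossings a b y n \<le> upcrossings a b y N" for n
    using Max_ge[OF fin, of "upcrossings a b y n"] by simp
  have stable: "upcrossings a b y (Suc n) = upcrossings a b y n" if "n \<ge> N" for n
    using N[of "Suc n"] monoD[OF \<open>mono _\<close>, of N n] monoD[OF \<open>mono _\<close>, of n "Suc n"] that by simp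
  have stay: "?h (Suc n)" if "n \<ge> N" "?h n" for n
    using stable[OF that(1)] that(2) by (auto split: if_splits)
  show False
  proof (cases "\<exists>n\<ge>N. ?h n")
    case True
    then obtain n where n: "n \<ge> N" "?h n" by blast
    have "?h (n + k)" for k
      by (induction k) (use n stay in \<open>auto simp del: holding.simps\<close>)
    moreover have "y (n + Suc k) < b" if "?h (n + k)" "?h (n + Suc k)" for k
      using that by simp
    ultimately have "y (n + Suc k) < b" for k by blast
    then have "y m < b" if "m \<ge> Suc n" for m
      using that by (metis add_Suc_shift le_iff_add)
    then have "\<forall>\<^sub>F m in sequentially. \<not> b \<le> y m"
      unfolding eventually_sequentially by (meson not_le)
    with high show False by (simp add: frequently_def)
  next
    case False
    have "y m > a" if m: "m \<ge> Suc N" for m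
    proof -
      obtain m' where "m = Suc m'" "m' \<ge> N" using Suc_le_D[OF m] m by auto
      with False show ?thesis by (metis holding.simps(2) le_SucI not_le)
    qed
    then have "\<forall>\<^sub>F m in sequentially. \<not> y m \<le> a"
      unfolding eventually_sequentially by (meson not_le)
    with low show False by (simp add: frequently_def)
  qed
qed

text \<open>A gap between the extended lower and upper limits would contain two rationals, between
  which \<open>y\<close> oscillates. Rational thresholds suffice, which later keeps the exceptional
  null sets countable in number.\<close>

lemma convergent_if_no_oscillation:
  fixes y :: "nat \<Rightarrow> real"
  assumes nonneg: "\<And>n. 0 \<le> y n"
    and rec: "\<exists>\<^sub>F n in sequentially. y n \<le> C"
    and osc: "\<And>a b. a \<in> \<rat> \<Longrightarrow> b \<in> \<rat> \<Longrightarrow> a < b \<Longrightarrow>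
      \<not> ((\<exists>\<^sub>F n in sequentially. y n \<le> a) \<and> (\<exists>\<^sub>F n in sequentially. b \<le> y n))"
  shows "convergent y"
proof -
  let ?l = "liminf (\<lambda>n. ereal (y n))" and ?u = "limsup (\<lambda>n. ereal (y n))"
  have low: "\<exists>\<^sub>F n in sequentially. y n \<le> a" if "?l < ereal a" for a
  proof (rule ccontr)
    assume "\<not> ?thesis"
    then have "\<forall>\<^sub>F n in sequentially. ereal a \<le> ereal (y n)"
      by (auto simp: not_frequently not_le elim: eventually_mono)
    from Liminf_bounded[OF this] that show False by simp
  qed
  have high: "\<exists>\<^sub>F n in sequentially. b \<le> y n" if "ereal b < ?u" for b
  proof (rule ccontr)
    assume "\<not> ?thesis"
    then have "\<forall>\<^sub>F n in sequentially. ereal (y n) \<le> ereal b"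
      by (auto simp: not_frequently not_le elim: eventually_mono)
    from Limsup_bounded[OF this] that show False by simp
  qed
  have lu: "?l \<le> ?u" by (rule Liminf_le_Limsup) simp
  have eq: "?l = ?u"
  proof (rule ccontr)
    assume "?l \<noteq> ?u"
    with lu have "?l < ?u" by simp
    then obtain r where r: "?l < ereal (real_of_rat r)" "ereal (real_of_rat r) < ?u"
      using ereal_dense3 by blast
    then obtain s where s: "ereal (real_of_rat r) < ereal (real_of_rat s)" "ereal (real_of_rat s) < ?u"
      using ereal_dense3 by blast
    show False
      using osc[of "real_of_rat r" "real_of_rat s"] low[OF r(1)] high[OF s(2)] s(1) by auto
  qed
  have "0 \<le> ?l"
    by (rule Liminf_bounded) (simp add: nonneg)
  \<comment> \<open>Absence of oscillation alone permits divergence to infinity. Since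
    \<open>y\<close> returns below \<open>C\<close> infinitely often, an infinite upper limit would
    give oscillation between any two rationals above \<open>C\<close>.\<close>
  moreover have "?u \<noteq> \<infinity>"
  proof
    assume u: "?u = \<infinity>"
    obtain r s where rs: "C < real_of_rat r" "real_of_rat r < real_of_rat s"
      by (meson of_rat_dense less_add_one)
    have "\<exists>\<^sub>F n in sequentially. y n \<le> real_of_rat r"
      using rec by (rule frequently_elim1) (use rs in simp)
    moreover have "\<exists>\<^sub>F n in sequentially. real_of_rat s \<le> y n"
      by (rule high) (simp add: u)
    ultimately show False using osc[of "real_of_rat r" "real_of_rat s"] rs by auto
  qed
  ultimately obtain l where "?u = ereal l"
    using eq by (cases ?u) auto
  then have "(\<lambda>n. ereal (y n)) \<longlonglongrightarrow> ereal l"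
    using eq by (intro Liminf_eq_Limsup) auto
  then show ?thesis by (auto simp: convergent_def)
qed

text \<open>Doob's argument: betting on a supermartingale with a strategy known in advance has
  nonpositive mean gain, so the mean number of upcrossings is bounded uniformly in time. Hence
  almost every path completes finitely many upcrossings of each rational interval.\<close>

lemma (in finite_measure) nonneg_supermartingale_convergent:
  fixes Y :: "nat \<Rightarrow> 'a \<Rightarrow> real"
  assumes sub: "\<And>k. subalgebra M (F k)" and filt: "\<And>k. subalgebra (F (Suc k)) (F k)"
    and adapted: "\<And>k. Y k \<in> borel_measurable (F k)"
    and int: "\<And>k. integrable M (Y k)"
    and nonneg: "\<And>k \<omega>. \<omega> \<in> space M \<Longrightarrow> 0 \<le> Y k \<omega>"
    and super: "\<And>k B. B \<in> sets (F k) \<Longrightarrow>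
      (LINT \<omega>:B|M. Y (Suc k) \<omega>) \<le> (LINT \<omega>:B|M. Y k \<omega>)"
  shows "AE \<omega> in M. convergent (\<lambda>k. Y k \<omega>)"
proof -
  have [measurable]: "Y k \<in> borel_measurable M" for k
    using int by auto
  have hold_F: "Measurable.pred (F k) (\<lambda>\<omega>. holding a b (\<lambda>k. Y k \<omega>) k)" for a b k
  proof (induction k)
    case 0
    have [measurable]: "Y 0 \<in> borel_measurable (F 0)" by (rule adapted)
    show ?case by simp
  next
    case (Suc k)
    have [measurable]: "Y (Suc k) \<in> borel_measurable (F (Suc k))" by (rule adapted)
    have [measurable]: "Measurable.pred (F (Suc k)) (\<lambda>\<omega>. holding a b (\<lambda>k. Y k \<omega>) k)"
      by (rule measurable_from_subalg[OF filt Suc])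
    show ?case by simp
  qed
  have hold_M [measurable]: "Measurable.pred M (\<lambda>\<omega>. holding a b (\<lambda>k. Y k \<omega>) k)" for a b k
    by (rule measurable_from_subalg[OF sub hold_F])
  have up_M [measurable]: "(\<lambda>\<omega>. upcrossings a b (\<lambda>k. Y k \<omega>) n) \<in> measurable M (count_space UNIV)" for a b n
    by (induction n) simp_all
  have up_bound: "AE \<omega> in M. \<exists>C. \<forall>n. upcrossings a b (\<lambda>k. Y k \<omega>) n \<le> C" if ab: "a < b" for a b :: real
  proof -
    define U where "U n \<omega> = upcrossings a b (\<lambda>k. Y k \<omega>) n" for n \<omega>
    define H where "H k \<omega> = (of_bool (holding a b (\<lambda>k. Y k \<omega>) k) :: real)" for k \<omega>
    have [measurable]: "U n \<in> measurable M (count_space UNIV)" for n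
      unfolding U_def by measurable
    have [measurable]: "H n \<in> borel_measurable M" for n
      unfolding H_def of_bool_def by measurable
    have U_le: "U n \<omega> \<le> n" for n \<omega>
      unfolding U_def by (induction n) auto
    have intU: "integrable M (\<lambda>\<omega>. real (U n \<omega>))" for n
      by (rule integrable_const_bound[where B = n]) (use U_le in auto)
    have intG: "integrable M (\<lambda>\<omega>. H k \<omega> * (Y (Suc k) \<omega> - Y k \<omega>))" for k
      by (rule Bochner_Integration.integrable_bound[of _ "\<lambda>\<omega>. Y (Suc k) \<omega> - Y k \<omega>"])
        (auto simp: int H_def)
    \<comment> \<open>Whether the trader holds between times \<open>k\<close> and
      \<open>k + 1\<close> is decided in \<open>F k\<close>, so the mean gain of this bet is an
      integral over a set on which \<open>super\<close> can be tested.\<close>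
    have G_le: "(\<integral>\<omega>. H k \<omega> * (Y (Suc k) \<omega> - Y k \<omega>) \<partial>M) \<le> 0" for k
    proof -
      let ?B = "{\<omega> \<in> space M. holding a b (\<lambda>k. Y k \<omega>) k}"
      have B: "?B \<in> sets (F k)"
        using hold_F[where k = k and a = a and b = b] sub[of k] by (simp add: pred_def subalgebra_def)
      then have BM: "?B \<in> sets M" using sub[of k] by (auto simp: subalgebra_def)
      have "(\<integral>\<omega>. H k \<omega> * (Y (Suc k) \<omega> - Y k \<omega>) \<partial>M)
          = (LINT \<omega>:?B|M. Y (Suc k) \<omega> - Y k \<omega>)"
        unfolding set_lebesgue_integral_def
        by (rule Bochner_Integration.integral_cong) (auto simp: H_def indicator_def)
      also have "\<dots> = (LINT \<omega>:?B|M. Y (Suc k) \<omega>) - (LINT \<omega>:?B|M. Y k \<omega>)"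
        by (intro set_integral_diff(2); unfold set_integrable_def; intro integrable_mult_indicator BM int)
      also have "\<dots> \<le> 0" using super[OF B] by simp
      finally show ?thesis .
    qed
    \<comment> \<open>Since \<open>Y\<close> is nonnegative, an open position is worth at least
      \<open>- a\<close>, hence at least \<open>- \<bar>a\<bar>\<close>; this is the only loss to be
      compensated, and it does not depend on \<open>n\<close>.\<close>
    have "(\<integral>\<omega>. real (U n \<omega>) \<partial>M) \<le> \<bar>a\<bar> * measure M (space M) / (b - a)" for n
    proof -
      have "(b - a) * (\<integral>\<omega>. real (U n \<omega>) \<partial>M) - \<bar>a\<bar> * measure M (space M)
          = (\<integral>\<omega>. (b - a) * real (U n \<omega>) - \<bar>a\<bar> \<partial>M)"
        using intU by simp
      also have "\<dots> \<le> (\<integral>\<omega>. (\<Sum>k<n. H k \<omega> * (Y (Suc k) \<omega> - Y k \<omega>)) \<partial>M)"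
      proof (rule integral_mono)
        fix \<omega> assume "\<omega> \<in> space M"
        then show "(b - a) * real (U n \<omega>) - \<bar>a\<bar> \<le> (\<Sum>k<n. H k \<omega> * (Y (Suc k) \<omega> - Y k \<omega>))"
          using upcrossings_gain[OF ab, of "\<lambda>k. Y k \<omega>" n] nonneg[of \<omega> n]
          unfolding U_def H_def by (auto split: if_splits)
      qed (use intU intG in auto)
      also have "\<dots> = (\<Sum>k<n. \<integral>\<omega>. H k \<omega> * (Y (Suc k) \<omega> - Y k \<omega>) \<partial>M)"
        using intG by simp
      also have "\<dots> \<le> 0" using G_le by (simp add: sum_nonpos)
      finally show ?thesis using ab by (simp add: field_simps)
    qed
    then have "(\<integral>\<^sup>+\<omega>. ennreal (real (U n \<omega>)) \<partial>M) \<le> ennreal (\<bar>a\<bar> * measure M (space M) / (b - a))" for n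
      by (subst nn_integral_eq_integral[OF intU]) (auto intro: ennreal_leI)
    moreover have "incseq (\<lambda>n \<omega>. ennreal (real (U n \<omega>)))"
      by (rule incseq_SucI) (auto simp: le_fun_def U_def intro!: ennreal_leI)
    ultimately have "(\<integral>\<^sup>+\<omega>. (SUP n. ennreal (real (U n \<omega>))) \<partial>M)
        \<le> ennreal (\<bar>a\<bar> * measure M (space M) / (b - a))"
      by (subst nn_integral_monotone_convergence_SUP) (auto intro: SUP_least)
    then have "(\<integral>\<^sup>+\<omega>. (SUP n. ennreal (real (U n \<omega>))) \<partial>M) \<noteq> \<infinity>"
      by (auto simp: top_unique)
    then have "AE \<omega> in M. (SUP n. ennreal (real (U n \<omega>))) \<noteq> \<infinity>"
      by (intro nn_integral_PInf_AE) auto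
    then show ?thesis
    proof (rule AE_mp, intro AE_I2 impI)
      fix \<omega> assume "(SUP n. ennreal (real (U n \<omega>))) \<noteq> \<infinity>"
      then obtain C where C: "(SUP n. ennreal (real (U n \<omega>))) < of_nat C"
        using ennreal_Ex_less_of_nat by (metis infinity_ennreal_def less_top)
      have "U n \<omega> \<le> C" for n
      proof -
        have "ennreal (real (U n \<omega>)) \<le> of_nat C"
          by (rule order.trans[OF SUP_upper less_imp_le[OF C]]) simp
        then show ?thesis by (simp add: ennreal_of_nat_eq_real_of_nat)
      qed
      then show "\<exists>C. \<forall>n. upcrossings a b (\<lambda>k. Y k \<omega>) n \<le> C"
        unfolding U_def by blast
    qed
  qed
  \<comment> \<open>Countably many pairs of rationals, hence a single null set for all of
    them.\<close>
  have up_AE: "AE \<omega> in M. \<forall>a\<in>\<rat>. \<forall>b\<in>\<rat>. a < b \<longrightarrow> (\<exists>C. \<forall>n. upcrossings a b (\<lambda>k. Y k \<omega>) n \<le> C)"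
    using up_bound by (auto simp: AE_ball_countable countable_rat)
  \<comment> \<open>With bounded means, Fatou's lemma makes the lower limit finite almost
    everywhere. This excludes divergence to infinity, which finitely many upcrossings would
    not.\<close>
  have mean: "(\<integral>\<omega>. Y n \<omega> \<partial>M) \<le> (\<integral>\<omega>. Y 0 \<omega> \<partial>M)" for n
  proof (induction n)
    case (Suc n)
    have "space M \<in> sets (F n)" using sub[of n] by (metis sets.top subalgebra_def)
    from super[OF this] have "(\<integral>\<omega>. Y (Suc n) \<omega> \<partial>M) \<le> (\<integral>\<omega>. Y n \<omega> \<partial>M)"
      using int by (simp add: set_integral_space)
    with Suc show ?case by simp
  qed simp
  have "(\<integral>\<^sup>+\<omega>. liminf (\<lambda>n. ennreal (Y n \<omega>)) \<partial>M) \<le> liminf (\<lambda>n. \<integral>\<^sup>+\<omega>. ennreal (Y n \<omega>) \<partial>M)"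
    by (rule nn_integral_liminf) auto
  also have "\<dots> \<le> liminf (\<lambda>n::nat. ennreal (\<integral>\<omega>. Y 0 \<omega> \<partial>M))"
    using nonneg mean by (intro Liminf_mono always_eventually allI)
      (subst nn_integral_eq_integral[OF int], auto intro: ennreal_leI)
  also have "\<dots> < \<infinity>" by (simp add: Liminf_const)
  finally have "AE \<omega> in M. liminf (\<lambda>n. ennreal (Y n \<omega>)) \<noteq> \<infinity>"
    by (intro nn_integral_PInf_AE) auto
  then show ?thesis
    using up_AE AE_space
  proof eventually_elim
    case (elim \<omega>)
    from elim(1) obtain C where C: "liminf (\<lambda>n. ennreal (Y n \<omega>)) < of_nat C"
      using ennreal_Ex_less_of_nat by (metis infinity_ennreal_def less_top)
    have "\<exists>\<^sub>F n in sequentially. Y n \<omega> \<le> real C"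
    proof (rule ccontr)
      assume "\<not> ?thesis"
      then have "\<forall>\<^sub>F n in sequentially. of_nat C \<le> ennreal (Y n \<omega>)"
        by (auto simp: not_frequently not_le ennreal_of_nat_eq_real_of_nat intro: ennreal_leI
            elim!: eventually_mono)
      from Liminf_bounded[OF this] C show False by simp
    qed
    then show ?case
      using elim(2) nonneg[OF elim(3)] bounded_upcrossings_no_oscillation
      by (intro convergent_if_no_oscillation[where C = "real C"]) blast+
  qed
qed

text \<open>The Robbins-Siegmund idea for deterministic error sequences: a deterministic rescaling
  and shift turn \<open>V\<close> into a genuine supermartingale \<open>Y\<close>. Both
  \<open>p\<close> and \<open>r\<close> converge, so convergence of \<open>Y\<close> carries back to
  \<open>V\<close>.\<close>

lemma (in finite_measure) almost_supermartingale_convergent: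
  fixes V :: "nat \<Rightarrow> 'a \<Rightarrow> real" and c d :: "nat \<Rightarrow> real"
  assumes sub: "\<And>k. subalgebra M (F k)" and filt: "\<And>k. subalgebra (F (Suc k)) (F k)"
    and adapted: "\<And>k. V k \<in> borel_measurable (F k)"
    and int: "\<And>k. integrable M (V k)"
    and nonneg: "\<And>k \<omega>. \<omega> \<in> space M \<Longrightarrow> 0 \<le> V k \<omega>"
    and c: "\<And>k. 0 \<le> c k" "summable c" and d: "\<And>k. 0 \<le> d k" "summable d"
    and almost: "\<And>k B. B \<in> sets (F k) \<Longrightarrow>
      (LINT \<omega>:B|M. V (Suc k) \<omega>) \<le> (1 + c k) * (LINT \<omega>:B|M. V k \<omega>) + d k * measure M B"
  shows "AE \<omega> in M. convergent (\<lambda>k. V k \<omega>)"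
proof -
  define p where "p k = (\<Prod>t<k. 1 + c t)" for k
  \<comment> \<open>The index is \<open>Suc t\<close> because the error \<open>d t\<close> appears
    in the bound for \<open>V (Suc t)\<close>, which is divided by \<open>p (Suc t)\<close>.\<close>
  define e where "e t = d t / p (Suc t)" for t
  define r where "r k = suminf e - sum e {..<k}" for k
  have p1: "1 \<le> p k" for k unfolding p_def by (intro prod_ge_1) (simp add: c)
  have e0: "0 \<le> e k" for k using d p1[of "Suc k"] by (simp add: e_def)
  have "e k \<le> d k" for k using d(1)[of k] p1[of "Suc k"] by (simp add: e_def field_simps mult_le_cancel_left1)
  then have sum_e: "summable e"
    using e0 by (intro summable_comparison_test'[OF d(2)]) auto
  have r0: "0 \<le> r k" for k
    unfolding r_def using sum_le_suminf[OF sum_e, of "{..<k}"] e0 by simp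
  have "r \<longlonglongrightarrow> suminf e - suminf e"
    unfolding r_def by (intro tendsto_intros summable_LIMSEQ sum_e)
  then have conv_r: "convergent r" by (auto simp: convergent_def)
  have p_exp: "p k \<le> exp (suminf c)" for k
  proof -
    have "p k \<le> (\<Prod>t<k. exp (c t))"
      unfolding p_def by (intro prod_mono) (auto simp: c add_nonneg_nonneg exp_ge_add_one_self)
    also have "\<dots> = exp (sum c {..<k})" by (simp add: exp_sum)
    also have "\<dots> \<le> exp (suminf c)" using sum_le_suminf[OF c(2), of "{..<k}"] c(1) by simp
    finally show ?thesis .
  qed
  have "incseq p"
    using order_trans[OF zero_le_one p1] c(1)
    by (intro incseq_SucI) (simp add: p_def distrib_left)
  then have conv_p: "convergent p"
    using p_exp p1 by (metis convergent_def incseq_convergent)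
  \<comment> \<open>dividing by \<open>p\<close> absorbs the factors \<open>1 + c k\<close>; adding the tail \<open>r\<close> absorbs the errors \<open>d k\<close>\<close>
  define Y where "Y k \<omega> = V k \<omega> / p k + r k" for k \<omega>
  have "AE \<omega> in M. convergent (\<lambda>k. Y k \<omega>)"
  proof (rule nonneg_supermartingale_convergent[where F = F, OF sub filt])
    show "Y k \<in> borel_measurable (F k)" for k
      using adapted[of k] unfolding Y_def[abs_def] by measurable
    show "integrable M (Y k)" for k
      unfolding Y_def[abs_def] using int by simp
    show "0 \<le> Y k \<omega>" if "\<omega> \<in> space M" for k \<omega>
      using nonneg[OF that, of k] r0[of k] p1[of k] by (simp add: Y_def)
    fix k B assume B: "B \<in> sets (F k)"
    then have BM: "B \<in> sets M" using sub[of k] by (auto simp: subalgebra_def)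
    have setint: "set_integrable M B (V k)" for k
      unfolding set_integrable_def by (intro integrable_mult_indicator BM int)
    have Y_int: "(LINT \<omega>:B|M. Y k \<omega>) = (LINT \<omega>:B|M. V k \<omega>) / p k + r k * measure M B" for k
    proof -
      have "set_integrable M B (\<lambda>\<omega>. V k \<omega> / p k)" "set_integrable M B (\<lambda>\<omega>. r k)"
        using setint[of k] BM by (auto simp: set_integrable_def emeasure_eq_measure)
      then have "(LINT \<omega>:B|M. Y k \<omega>) = (LINT \<omega>:B|M. V k \<omega> / p k) + (LINT \<omega>:B|M. r k)"
        unfolding Y_def by (rule set_integral_add)
      then show ?thesis using BM by (simp add: set_integral_const emeasure_eq_measure mult.commute)
    qed
    have pS: "p (Suc k) = p k * (1 + c k)" by (simp add: p_def)
    have rS: "r k = d k / p (Suc k) + r (Suc k)" by (simp add: r_def e_def)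
    have "(LINT \<omega>:B|M. Y (Suc k) \<omega>)
        \<le> ((1 + c k) * (LINT \<omega>:B|M. V k \<omega>) + d k * measure M B) / p (Suc k) + r (Suc k) * measure M B"
      unfolding Y_int using almost[OF B] p1[of "Suc k"] by (simp add: divide_right_mono)
    also have "\<dots> = (LINT \<omega>:B|M. Y k \<omega>)"
      unfolding Y_int rS unfolding pS using p1[of k] c(1)[of k] by (simp add: field_simps add_nonneg_eq_0_iff)
    finally show "(LINT \<omega>:B|M. Y (Suc k) \<omega>) \<le> (LINT \<omega>:B|M. Y k \<omega>)" .
  qed
  then show ?thesis
  proof eventually_elim
    case (elim \<omega>)
    have "(\<lambda>k. V k \<omega>) = (\<lambda>k. (Y k \<omega> - r k) * p k)"
      using p1 by (auto simp: Y_def fun_eq_iff) (metis less_numeral_extra(1) not_le zero_less_one)+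
    with elim conv_r conv_p show ?case
      by (simp add: convergent_diff convergent_mult)
  qed
qed

subsection \<open>Convexity and the Laplacian\<close>

text \<open>Convexity is available only on \<open>S\<close>, but the whole segment from
  \<open>y\<close> to \<open>z\<close> lies there. Along it the difference quotients at
  \<open>y\<close> are at most the chord slope \<open>f z - f y\<close>; the right-hand limit at 0
  gives the claim.\<close>

lemma convex_on_gradient_inequality:
  fixes f :: "'a::euclidean_space \<Rightarrow> real"
  assumes f: "convex_on S f" and S: "y \<in> S" "z \<in> S"
    and grad: "(f has_derivative (\<lambda>h. g \<bullet> h)) (at y)"
  shows "f y + g \<bullet> (z - y) \<le> f z"
proof -
  let ?\<phi> = "\<lambda>t. f (y + t *\<^sub>R (z - y))"
  have "(?\<phi> has_derivative (\<lambda>t. g \<bullet> (t *\<^sub>R (z - y)))) (at 0)"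
    by (rule has_derivative_compose[where g = f, of "\<lambda>t. y + t *\<^sub>R (z - y)"])
      (auto intro!: derivative_eq_intros grad)
  then have "(?\<phi> has_real_derivative g \<bullet> (z - y)) (at 0)"
    by (simp add: has_field_derivative_def mult_commute_abs)
  then have "((\<lambda>t. (?\<phi> t - f y) / t) \<longlongrightarrow> g \<bullet> (z - y)) (at_right 0)"
    by (simp add: has_field_derivative_iff filterlim_at_split)
  moreover have "\<forall>\<^sub>F t in at_right 0. (?\<phi> t - f y) / t \<le> f z - f y"
    unfolding eventually_at_right_field
  proof (intro exI[of _ 1] conjI allI impI)
    fix t :: real assume t: "0 < t" "t < 1"
    have "?\<phi> t = f ((1 - t) *\<^sub>R y + t *\<^sub>R z)" by (simp add: algebra_simps)
    also have "\<dots> \<le> (1 - t) * f y + t * f z"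
      using convex_onD[OF f, of t y z] t S by simp
    finally show "(?\<phi> t - f y) / t \<le> f z - f y" using t by (simp add: field_simps)
  qed simp
  ultimately have "g \<bullet> (z - y) \<le> f z - f y"
    by (intro tendsto_upperbound) auto
  then show ?thesis by simp
qed

text \<open>The \<open>i\<close>-th block of the Laplacian of \<open>A\<close>, tensored with the
  identity, applied to \<open>Y\<close>. The difference form is the one in which the algorithm
  presents it.\<close>

abbreviation disagreement :: "real^'n::finite^'n \<Rightarrow> ('n \<Rightarrow> 'a::euclidean_space) \<Rightarrow> 'n \<Rightarrow> 'a" where
  "disagreement A Y i \<equiv> \<Sum>j\<in>UNIV. A $ i $ j *\<^sub>R (Y i - Y j)"

lemma laplacian_bilinear:
  "(\<Sum>i\<in>UNIV. \<Sum>j\<in>UNIV. laplacian A $ i $ j * (\<Lambda> i \<bullet> X j))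
    = (\<Sum>i\<in>UNIV. \<Lambda> i \<bullet> disagreement A X i)"
proof (rule sum.cong)
  fix i
  have "(\<Sum>j\<in>UNIV. laplacian A $ i $ j * (\<Lambda> i \<bullet> X j))
      = (\<Sum>j\<in>UNIV. (if i = j then (\<Sum>l\<in>UNIV. A $ i $ l) * (\<Lambda> i \<bullet> X j) else 0))
        - (\<Sum>j\<in>UNIV. A $ i $ j * (\<Lambda> i \<bullet> X j))"
    unfolding sum_subtractf[symmetric] by (rule sum.cong) (simp_all add: laplacian_def left_diff_distrib)
  also have "\<dots> = \<Lambda> i \<bullet> disagreement A X i"
    by (simp add: inner_sum_right inner_diff_right right_diff_distrib sum_subtractf sum_distrib_right)
  finally show "(\<Sum>j\<in>UNIV. laplacian A $ i $ j * (\<Lambda> i \<bullet> X j)) = \<Lambda> i \<bullet> disagreement A X i" .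
qed simp

text \<open>The degree part of the form is symmetric for every \<open>A\<close>; exchanging the
  summation indices handles the remaining part.\<close>

lemma disagreement_symmetric:
  assumes "\<And>i j. A $ i $ j = A $ j $ i"
  shows "(\<Sum>i\<in>UNIV. Y i \<bullet> disagreement A Z i) = (\<Sum>i\<in>UNIV. Z i \<bullet> disagreement A Y i)"
proof -
  have expand: "(\<Sum>i\<in>UNIV. Y i \<bullet> disagreement A Z i)
      = (\<Sum>i\<in>UNIV. \<Sum>j\<in>UNIV. A $ i $ j * (Y i \<bullet> Z i)) - (\<Sum>i\<in>UNIV. \<Sum>j\<in>UNIV. A $ i $ j * (Y i \<bullet> Z j))"
    for Y Z :: "'a \<Rightarrow> 'b"
    by (simp add: inner_sum_right inner_diff_right right_diff_distrib sum_subtractf)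
  have "(\<Sum>i\<in>UNIV. \<Sum>j\<in>UNIV. A $ i $ j * (Y i \<bullet> Z j)) = (\<Sum>i\<in>UNIV. \<Sum>j\<in>UNIV. A $ i $ j * (Z i \<bullet> Y j))"
    by (subst sum.swap) (simp add: assms inner_commute)
  then show ?thesis unfolding expand by (simp add: inner_commute)
qed

text \<open>Adding the form to its copy with \<open>i\<close> and \<open>j\<close> exchanged gives
  twice the form as the weighted sum of all \<open>(norm (Y i - Y j))\<^sup>2\<close>.\<close>

lemma disagreement_psd:
  assumes sym: "\<And>i j. A $ i $ j = A $ j $ i" and nonneg: "\<And>i j. 0 \<le> A $ i $ j"
  shows "0 \<le> (\<Sum>i\<in>UNIV. Y i \<bullet> disagreement A Y i)"
proof -
  have "(\<Sum>i\<in>UNIV. \<Sum>j\<in>UNIV. A $ i $ j * (Y i \<bullet> (Y i - Y j)))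
      = (\<Sum>i\<in>UNIV. \<Sum>j\<in>UNIV. A $ i $ j * (Y j \<bullet> (Y j - Y i)))"
    by (subst sum.swap) (simp add: sym)
  then have "2 * (\<Sum>i\<in>UNIV. Y i \<bullet> disagreement A Y i)
      = (\<Sum>i\<in>UNIV. \<Sum>j\<in>UNIV. A $ i $ j * (Y i \<bullet> (Y i - Y j)))
        + (\<Sum>i\<in>UNIV. \<Sum>j\<in>UNIV. A $ i $ j * (Y j \<bullet> (Y j - Y i)))"
    by (simp add: inner_sum_right)
  also have "\<dots> = (\<Sum>i\<in>UNIV. \<Sum>j\<in>UNIV. A $ i $ j * (norm (Y i - Y j))\<^sup>2)"
    unfolding sum.distrib[symmetric]
    by (simp add: power2_norm_eq_inner algebra_simps inner_commute)
  also have "\<dots> \<ge> 0" by (intro sum_nonneg mult_nonneg_nonneg nonneg) auto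
  finally show ?thesis by simp
qed

text \<open>By symmetry the coupling terms of \<open>X\<close> with \<open>\<Lambda>\<close> cancel
  between the primal and the dual part. What remains is the quadratic form of \<open>X\<close> plus
  a quantity that, by the gradient inequality, is at least the Lagrangian gap between
  \<open>X\<close> and \<open>Xs\<close> at \<open>\<Lambda>s\<close>.\<close>

lemma saddle_drift_nonneg:
  fixes \<Omega> :: "'n::finite \<Rightarrow> 'a::euclidean_space set"
  assumes f_convex: "\<And>i. convex_on (\<Omega> i) (f i)"
    and f_grad: "\<And>i y. y \<in> \<Omega> i \<Longrightarrow> (f i has_derivative (\<lambda>h. g i y \<bullet> h)) (at y)"
    and sym: "\<And>i j. A $ i $ j = A $ j $ i" and nonneg: "\<And>i j. 0 \<le> A $ i $ j"
    and saddle: "saddle_point f (laplacian A) \<Omega> Xs \<Lambda>s"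
    and X: "\<And>i. X i \<in> \<Omega> i"
  shows "0 \<le> (\<Sum>i\<in>UNIV. (X i - Xs i) \<bullet> (g i (X i) + disagreement A \<Lambda> i + disagreement A X i)
    - (\<Lambda> i - \<Lambda>s i) \<bullet> disagreement A X i)"
proof -
  have Xs: "Xs i \<in> \<Omega> i" for i using saddle by (simp add: saddle_point_def)
  have max: "(\<Sum>i\<in>UNIV. \<Lambda> i \<bullet> disagreement A Xs i) \<le> (\<Sum>i\<in>UNIV. \<Lambda>s i \<bullet> disagreement A Xs i)" for \<Lambda>
    using saddle by (simp add: saddle_point_def lagrangian_def laplacian_bilinear)
  \<comment> \<open>The Lagrangian is affine in the multipliers, so a maximum in them forces its
    coefficient, the disagreement of \<open>Xs\<close>, to vanish. Moving \<open>\<Lambda>s\<close>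
    in the direction of that coefficient shows it.\<close>
  have "(\<Sum>i\<in>UNIV. (norm (disagreement A Xs i))\<^sup>2) \<le> 0"
    using max[of "\<lambda>i. \<Lambda>s i + disagreement A Xs i"]
    by (simp add: inner_add_left sum.distrib power2_norm_eq_inner)
  then have "(\<Sum>i\<in>UNIV. (norm (disagreement A Xs i))\<^sup>2) = 0"
    by (intro antisym sum_nonneg) auto
  then have consensus: "disagreement A Xs i = 0" for i
    by (simp add: sum_nonneg_eq_0_iff)
  have min: "(\<Sum>i\<in>UNIV. f i (Xs i)) \<le> (\<Sum>i\<in>UNIV. f i (X i)) + (\<Sum>i\<in>UNIV. \<Lambda>s i \<bullet> disagreement A X i)"
    using saddle X by (auto simp: saddle_point_def lagrangian_def laplacian_bilinear consensus)
  have "f i (X i) - f i (Xs i) \<le> (X i - Xs i) \<bullet> g i (X i)" for i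
    using convex_on_gradient_inequality[OF f_convex X Xs f_grad[OF X], of i]
    by (simp add: inner_commute algebra_simps)
  then have grad: "(\<Sum>i\<in>UNIV. f i (X i)) - (\<Sum>i\<in>UNIV. f i (Xs i)) \<le> (\<Sum>i\<in>UNIV. (X i - Xs i) \<bullet> g i (X i))"
    by (simp add: sum_subtractf[symmetric] sum_mono)
  \<comment> \<open>Symmetry moves the Laplacian onto \<open>Xs\<close>, where it vanishes.\<close>
  have cross: "(\<Sum>i\<in>UNIV. Xs i \<bullet> disagreement A Y i) = 0" for Y
    by (simp add: disagreement_symmetric[OF sym, of Xs] consensus)
  have "(\<Sum>i\<in>UNIV. (X i - Xs i) \<bullet> (g i (X i) + disagreement A \<Lambda> i + disagreement A X i)
      - (\<Lambda> i - \<Lambda>s i) \<bullet> disagreement A X i)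
    = (\<Sum>i\<in>UNIV. (X i - Xs i) \<bullet> g i (X i)) + (\<Sum>i\<in>UNIV. X i \<bullet> disagreement A \<Lambda> i)
      + (\<Sum>i\<in>UNIV. X i \<bullet> disagreement A X i) - (\<Sum>i\<in>UNIV. \<Lambda> i \<bullet> disagreement A X i)
      + (\<Sum>i\<in>UNIV. \<Lambda>s i \<bullet> disagreement A X i)
      - (\<Sum>i\<in>UNIV. Xs i \<bullet> disagreement A \<Lambda> i) - (\<Sum>i\<in>UNIV. Xs i \<bullet> disagreement A X i)"
    by (simp add: inner_diff_left inner_add_right sum.distrib sum_subtractf)
  then show ?thesis
    using grad min disagreement_psd[OF sym nonneg, of X] disagreement_symmetric[OF sym, of X \<Lambda>]
    by (simp add: cross)
qed

subsection \<open>Integrals against independent and conditionally centred factors\<close>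

lemma integrable_bound_norm_mult:
  fixes h :: "'a \<Rightarrow> real" and u :: "'a \<Rightarrow> 'b::real_normed_vector" and w :: "'a \<Rightarrow> 'c::real_normed_vector"
  assumes "h \<in> borel_measurable M"
    and u2: "integrable M (\<lambda>\<omega>. (norm (u \<omega>))\<^sup>2)" and w2: "integrable M (\<lambda>\<omega>. (norm (w \<omega>))\<^sup>2)"
    and le: "\<And>\<omega>. \<bar>h \<omega>\<bar> \<le> norm (u \<omega>) * norm (w \<omega>)"
  shows "integrable M h"
proof (rule Bochner_Integration.integrable_bound)
  show "integrable M (\<lambda>\<omega>. (norm (u \<omega>))\<^sup>2 + (norm (w \<omega>))\<^sup>2)" using u2 w2 by simp
  have "\<bar>h \<omega>\<bar> \<le> (norm (u \<omega>))\<^sup>2 + (norm (w \<omega>))\<^sup>2" for \<omega>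
    using le[of \<omega>] sum_squares_bound[of "norm (u \<omega>)" "norm (w \<omega>)", unfolded mult.assoc]
      mult_nonneg_nonneg[OF norm_ge_zero[of "u \<omega>"] norm_ge_zero[of "w \<omega>"]] by linarith
  then show "AE \<omega> in M. norm (h \<omega>) \<le> norm ((norm (u \<omega>))\<^sup>2 + (norm (w \<omega>))\<^sup>2)"
    by simp
qed fact

lemma integrable_inner_of_squares:
  fixes u w :: "'a \<Rightarrow> 'b::euclidean_space"
  assumes [measurable]: "u \<in> borel_measurable M" "w \<in> borel_measurable M"
    and "integrable M (\<lambda>\<omega>. (norm (u \<omega>))\<^sup>2)" "integrable M (\<lambda>\<omega>. (norm (w \<omega>))\<^sup>2)"
  shows "integrable M (\<lambda>\<omega>. u \<omega> \<bullet> w \<omega>)"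
  by (rule integrable_bound_norm_mult[OF _ assms(3,4) Cauchy_Schwarz_ineq2]) measurable

text \<open>\<open>real_cond_exp\<close> acts on real functions, so the known factor is taken out
  coordinate by coordinate. Square integrability of both factors makes each coordinate product
  integrable.\<close>

lemma (in sigma_finite_subalgebra) integral_inner_cond_mean_zero:
  fixes u w :: "'a \<Rightarrow> 'b::euclidean_space"
  assumes [measurable]: "u \<in> borel_measurable F" "w \<in> borel_measurable M"
    and u2: "integrable M (\<lambda>\<omega>. (norm (u \<omega>))\<^sup>2)" and w2: "integrable M (\<lambda>\<omega>. (norm (w \<omega>))\<^sup>2)"
    and zero: "\<And>b. b \<in> Basis \<Longrightarrow> AE \<omega> in M. real_cond_exp M F (\<lambda>\<omega>. w \<omega> \<bullet> b) \<omega> = 0"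
  shows "integrable M (\<lambda>\<omega>. u \<omega> \<bullet> w \<omega>)" "(\<integral>\<omega>. u \<omega> \<bullet> w \<omega> \<partial>M) = 0"
proof -
  have [measurable]: "u \<in> borel_measurable M"
    by (rule measurable_from_subalg[OF subalg]) simp
  have int: "integrable M (\<lambda>\<omega>. (u \<omega> \<bullet> b) * (w \<omega> \<bullet> b))" if b: "b \<in> Basis" for b
  proof (rule integrable_bound_norm_mult[OF _ u2 w2])
    show "\<bar>(u \<omega> \<bullet> b) * (w \<omega> \<bullet> b)\<bar> \<le> norm (u \<omega>) * norm (w \<omega>)" for \<omega>
      unfolding abs_mult by (intro mult_mono Basis_le_norm b) auto
  qed measurable
  have "(\<integral>\<omega>. (u \<omega> \<bullet> b) * (w \<omega> \<bullet> b) \<partial>M) = 0" if b: "b \<in> Basis" for b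
  proof -
    have "(\<integral>\<omega>. (u \<omega> \<bullet> b) * (w \<omega> \<bullet> b) \<partial>M)
        = (\<integral>\<omega>. (u \<omega> \<bullet> b) * real_cond_exp M F (\<lambda>\<omega>. w \<omega> \<bullet> b) \<omega> \<partial>M)"
      by (rule real_cond_exp_intg(2)[symmetric]) (use int[OF b] in auto)
    also have "\<dots> = 0" using zero[OF b] by (intro integral_eq_zero_AE) auto
    finally show ?thesis .
  qed
  then show "integrable M (\<lambda>\<omega>. u \<omega> \<bullet> w \<omega>)" "(\<integral>\<omega>. u \<omega> \<bullet> w \<omega> \<partial>M) = 0"
    using int unfolding euclidean_inner[of "u \<omega>" "w \<omega>" for \<omega>] by simp_all
qed

lemma sigma_sets_vimage_eq:
  "sigma_sets S {f -` B \<inter> S | B. B \<in> sets N} = {f -` B \<inter> S | B. B \<in> sets N}" if "f \<in> S \<rightarrow> space N"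
  using sets_vimage_algebra[of S f N] sets_vimage_algebra2[OF that] by simp

text \<open>The events of \<open>\<phi> (Z \<omega>)\<close> are events of \<open>Z\<close>, and
  those of \<open>h\<close> belong to \<open>F\<close>, so independence is inherited. Besides
  selecting a matrix entry, \<open>\<phi>\<close> brings both variables to one value type, as
  \<open>indep_var\<close> demands.\<close>

lemma (in prob_space) indep_var_of_indep_set:
  fixes h :: "'a \<Rightarrow> 'c::topological_space"
  assumes Z [measurable]: "Z \<in> borel_measurable M" and sub: "subalgebra M F"
    and indep: "indep_set {Z -` B \<inter> space M | B. B \<in> sets borel} (sets F)"
    and phi [measurable]: "\<phi> \<in> borel_measurable borel" and h: "h \<in> borel_measurable F"
  shows "indep_var borel (\<lambda>\<omega>. \<phi> (Z \<omega>)) borel h"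
proof -
  let ?X = "\<lambda>\<omega>. \<phi> (Z \<omega>)"
  have hM: "h \<in> borel_measurable M" by (rule measurable_from_subalg[OF sub h])
  have h_sets: "{h -` B \<inter> space M | B. B \<in> sets borel} \<subseteq> sets F"
    using measurable_sets[OF h] sub by (auto simp: subalgebra_def)
  have X_sets: "{?X -` B \<inter> space M | B. B \<in> sets borel} \<subseteq> {Z -` B \<inter> space M | B. B \<in> sets borel}"
  proof clarify
    fix B :: "'c set" assume "B \<in> sets borel"
    then have "\<phi> -` B \<in> sets borel" using measurable_sets_borel[OF phi] by simp
    moreover have "?X -` B \<inter> space M = Z -` (\<phi> -` B) \<inter> space M" by auto
    ultimately show "\<exists>B'. ?X -` B \<inter> space M = Z -` B' \<inter> space M \<and> B' \<in> sets borel" by blast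
  qed
  have "indep_set {?X -` B \<inter> space M | B. B \<in> sets borel} {h -` B \<inter> space M | B. B \<in> sets borel}"
    unfolding indep_set_def
  proof (rule indep_sets_mono_sets[OF indep[unfolded indep_set_def]])
    fix i
    show "case_bool {?X -` B \<inter> space M | B. B \<in> sets borel} {h -` B \<inter> space M | B. B \<in> sets borel} i
        \<subseteq> case_bool {Z -` B \<inter> space M | B. B \<in> sets borel} (sets F) i"
      using h_sets X_sets by (cases i) auto
  qed
  then show ?thesis
    unfolding indep_var_eq using hM
    by (subst (1 2) sigma_sets_vimage_eq) auto
qed

text \<open>Extended nonnegative values allow product moments to be factored before anything is
  known to be integrable.\<close>

lemma (in prob_space) indep_var_nn_integral:
  fixes X Y :: "'a \<Rightarrow> ennreal"
  assumes "indep_var borel X borel Y"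
  shows "(\<integral>\<^sup>+\<omega>. X \<omega> * Y \<omega> \<partial>M) = (\<integral>\<^sup>+\<omega>. X \<omega> \<partial>M) * (\<integral>\<^sup>+\<omega>. Y \<omega> \<partial>M)"
proof -
  have borel: "(\<lambda>_. borel) = case_bool borel borel"
    by (auto simp: fun_eq_iff split: bool.split)
  have "indep_vars (\<lambda>_. borel) (case_bool X Y) UNIV"
    using assms unfolding indep_var_def borel .
  from indep_vars_nn_integral[OF finite this] show ?thesis
    by (simp add: UNIV_bool mult.commute)
qed

lemma set_nn_integral_eq_set_integral:
  fixes q :: "'a \<Rightarrow> real"
  assumes "B \<in> sets M" "integrable M q" "\<And>\<omega>. 0 \<le> q \<omega>"
  shows "(\<integral>\<^sup>+\<omega>\<in>B. ennreal (q \<omega>) \<partial>M) = ennreal (LINT \<omega>:B|M. q \<omega>)"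
proof -
  have "(\<integral>\<^sup>+\<omega>\<in>B. ennreal (q \<omega>) \<partial>M) = (\<integral>\<^sup>+\<omega>. ennreal (indicator B \<omega> *\<^sub>R q \<omega>) \<partial>M)"
    by (rule nn_integral_cong) (simp split: split_indicator)
  also have "\<dots> = ennreal (LINT \<omega>:B|M. q \<omega>)"
    unfolding set_lebesgue_integral_def
    by (rule nn_integral_eq_integral[OF integrable_mult_indicator[OF assms(1,2)]]) (simp add: assms(3))
  finally show ?thesis .
qed

section \<open>Information sigma-algebras\<close>

lemma space_info_sigma [simp]: "space (info_sigma M A wx wl v K N) = space M"
  unfolding info_sigma_def by (rule space_measure_of) auto

lemma sets_info_sigma:
  "sets (info_sigma M A wx wl v K N) = sigma_sets (space M)
     ({A t -` B \<inter> space M | t B. t \<in> K \<and> B \<in> sets borel}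
      \<union> {wx t i j -` B \<inter> space M | t i j B. t \<in> N \<and> B \<in> sets borel}
      \<union> {wl t i j -` B \<inter> space M | t i j B. t \<in> N \<and> B \<in> sets borel}
      \<union> {v t i -` B \<inter> space M | t i B. t \<in> N \<and> B \<in> sets borel})"
  unfolding info_sigma_def by (rule sets_measure_of) auto

lemma info_sigma_mono:
  assumes "K \<subseteq> K'" "N \<subseteq> N'"
  shows "subalgebra (info_sigma M A wx wl v K' N') (info_sigma M A wx wl v K N)"
proof -
  have "sets (info_sigma M A wx wl v K N) \<subseteq> sets (info_sigma M A wx wl v K' N')"
    unfolding sets_info_sigma using assms by (intro sigma_sets_mono' Un_mono Collect_mono) blast+
  then show ?thesis by (simp add: subalgebra_def)
qed

lemma subalgebra_info_sigma:
  assumes "\<And>t. A t \<in> borel_measurable M" "\<And>t i j. wx t i j \<in> borel_measurable M"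
    "\<And>t i j. wl t i j \<in> borel_measurable M" "\<And>t i. v t i \<in> borel_measurable M"
  shows "subalgebra M (info_sigma M A wx wl v K N)"
proof -
  have "sets (info_sigma M A wx wl v K N) \<subseteq> sets M"
    unfolding sets_info_sigma
    by (rule sets.sigma_sets_subset) (use assms[THEN measurable_sets] in auto)
  then show ?thesis by (simp add: subalgebra_def)
qed

lemma measurable_info_sigma:
  shows "t \<in> K \<Longrightarrow> A t \<in> borel_measurable (info_sigma M A wx wl v K N)"
    and "t \<in> N \<Longrightarrow> wx t i j \<in> borel_measurable (info_sigma M A wx wl v K N)"
    and "t \<in> N \<Longrightarrow> wl t i j \<in> borel_measurable (info_sigma M A wx wl v K N)"
    and "t \<in> N \<Longrightarrow> v t i \<in> borel_measurable (info_sigma M A wx wl v K N)"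
  by (rule measurableI; auto simp: sets_info_sigma intro!: sigma_sets.Basic)+

lemma borel_measurable_entry [measurable]:
  "(\<lambda>A::real^'n::finite^'m::finite. A $ i $ j) \<in> borel_measurable borel"
  by (intro borel_measurable_continuous_onI continuous_intros)

lemma norm_add_power2_le:
  fixes a b :: "'a::real_normed_vector"
  shows "(norm (a + b))\<^sup>2 \<le> 2 * (norm a)\<^sup>2 + 2 * (norm b)\<^sup>2"
proof -
  have "(norm (a + b))\<^sup>2 \<le> (norm a + norm b)\<^sup>2"
    by (simp add: norm_triangle_ineq power_mono)
  also have "\<dots> \<le> 2 * (norm a)\<^sup>2 + 2 * (norm b)\<^sup>2"
    using sum_squares_bound[of "norm a" "norm b"] by (simp add: power2_sum)
  finally show ?thesis .
qed

subsection \<open>The primal-dual recursion\<close>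

locale primal_dual = prob_space M
  for M :: "'b measure" +
  fixes \<Omega> :: "'n::finite \<Rightarrow> 'a::euclidean_space set"
    and f :: "'n \<Rightarrow> 'a \<Rightarrow> real"
    and g :: "'n \<Rightarrow> 'a \<Rightarrow> 'a"
    and A :: "nat \<Rightarrow> 'b \<Rightarrow> real^'n^'n"
    and wx wl :: "nat \<Rightarrow> 'n \<Rightarrow> 'n \<Rightarrow> 'b \<Rightarrow> 'a"
    and v :: "nat \<Rightarrow> 'n \<Rightarrow> 'b \<Rightarrow> 'a"
    and \<gamma> :: "nat \<Rightarrow> real"
    and x0 l0 :: "'n \<Rightarrow> 'a"
    and x lam :: "nat \<Rightarrow> 'n \<Rightarrow> 'b \<Rightarrow> 'a"
    and Lf \<eta> \<mu> cv :: real
    and Xs \<Lambda>s :: "'n \<Rightarrow> 'a"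
  assumes closed: "\<And>i. closed (\<Omega> i)" and convex: "\<And>i. convex (\<Omega> i)"
    and f_convex: "\<And>i. convex_on (\<Omega> i) (f i)"
    and f_grad: "\<And>i y. y \<in> \<Omega> i \<Longrightarrow> (f i has_derivative (\<lambda>h. g i y \<bullet> h)) (at y)"
    and A_meas: "\<And>k. A k \<in> borel_measurable M"
    and A_nonneg: "\<And>k i j \<omega>. \<omega> \<in> space M \<Longrightarrow> A k \<omega> $ i $ j \<ge> 0"
    and wx_meas: "\<And>k i j. wx k i j \<in> borel_measurable M"
    and wl_meas: "\<And>k i j. wl k i j \<in> borel_measurable M"
    and v_meas: "\<And>k i. v k i \<in> borel_measurable M"
    and x_init: "\<And>i \<omega>. \<omega> \<in> space M \<Longrightarrow> x 0 i \<omega> = x0 i"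
    and lam_init: "\<And>i \<omega>. \<omega> \<in> space M \<Longrightarrow> lam 0 i \<omega> = l0 i"
    and x_step: "\<And>k i \<omega>. \<omega> \<in> space M \<Longrightarrow> x (Suc k) i \<omega> = closest_point (\<Omega> i)
        (x k i \<omega> - \<gamma> k *\<^sub>R (g i (x k i \<omega>) + v k i \<omega>)
          - \<gamma> k *\<^sub>R (\<Sum>j\<in>{j. A k \<omega> $ i $ j > 0}. A k \<omega> $ i $ j *\<^sub>R (lam k i \<omega> - (lam k j \<omega> + wl k i j \<omega>)))
          - \<gamma> k *\<^sub>R (\<Sum>j\<in>{j. A k \<omega> $ i $ j > 0}. A k \<omega> $ i $ j *\<^sub>R (x k i \<omega> - (x k j \<omega> + wx k i j \<omega>))))"
    and lam_step: "\<And>k i \<omega>. \<omega> \<in> space M \<Longrightarrow> lam (Suc k) i \<omega> = lam k i \<omega>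
          + \<gamma> k *\<^sub>R (\<Sum>j\<in>{j. A k \<omega> $ i $ j > 0}. A k \<omega> $ i $ j *\<^sub>R (x k i \<omega> - (x k j \<omega> + wx k i j \<omega>)))"
    and lipschitz: "\<And>i y z. y \<in> \<Omega> i \<Longrightarrow> z \<in> \<Omega> i \<Longrightarrow> norm (g i y - g i z) \<le> Lf * norm (y - z)"
    and A_ident: "\<And>k. distr M borel (A k) = distr M borel (A 0)"
    and Abar_sym: "\<And>i j. mean_mat M (A 0) $ i $ j = mean_mat M (A 0) $ j $ i"
    and A_second: "\<And>k i j. (\<integral>\<^sup>+ \<omega>. ennreal ((A k \<omega> $ i $ j)\<^sup>2) \<partial>M) \<le> ennreal (\<eta>\<^sup>2)"
    and L_indep: "\<And>k. k \<ge> 1 \<Longrightarrow> indep_set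
        {A k -` B \<inter> space M | B. B \<in> sets borel}
        (sets (info_sigma M A wx wl v {..<k} {..<k}))"
    and wx_mean: "\<And>k i j b. b \<in> Basis \<Longrightarrow> AE \<omega> in M.
        real_cond_exp M (info_sigma M A wx wl v {..k} {..<k}) (\<lambda>\<omega>. wx k i j \<omega> \<bullet> b) \<omega> = 0"
    and wx_var: "\<And>k i j. AE \<omega> in M.
        nn_cond_exp M (info_sigma M A wx wl v {..k} {..<k}) (\<lambda>\<omega>. ennreal ((norm (wx k i j \<omega>))\<^sup>2)) \<omega>
          \<le> ennreal (\<mu>\<^sup>2)"
    and wl_mean: "\<And>k i j b. b \<in> Basis \<Longrightarrow> AE \<omega> in M.
        real_cond_exp M (info_sigma M A wx wl v {..k} {..<k}) (\<lambda>\<omega>. wl k i j \<omega> \<bullet> b) \<omega> = 0"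
    and wl_var: "\<And>k i j. AE \<omega> in M.
        nn_cond_exp M (info_sigma M A wx wl v {..k} {..<k}) (\<lambda>\<omega>. ennreal ((norm (wl k i j \<omega>))\<^sup>2)) \<omega>
          \<le> ennreal (\<mu>\<^sup>2)"
    and v_mean: "\<And>k i b. b \<in> Basis \<Longrightarrow> AE \<omega> in M.
        real_cond_exp M (info_sigma M A wx wl v {..k} {..<k}) (\<lambda>\<omega>. v k i \<omega> \<bullet> b) \<omega> = 0"
    and v_var: "\<And>k i. AE \<omega> in M.
        nn_cond_exp M (info_sigma M A wx wl v {..k} {..<k}) (\<lambda>\<omega>. ennreal ((norm (v k i \<omega>))\<^sup>2)) \<omega>
          \<le> ennreal (cv * (1 + (norm (x k i \<omega>))\<^sup>2))"
    and \<gamma>_sq: "summable (\<lambda>k. (\<gamma> k)\<^sup>2)"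
    and \<gamma>_nonneg: "\<And>k. 0 \<le> \<gamma> k"
    and cv_nonneg: "0 \<le> cv"
    and saddle: "saddle_point f (mean_mat M (\<lambda>\<omega>. laplacian (A 0 \<omega>))) \<Omega> Xs \<Lambda>s"
begin

section \<open>Filtration, step directions and Lyapunov function\<close>

abbreviation past :: "nat \<Rightarrow> 'b measure" where
  "past k \<equiv> info_sigma M A wx wl v {..<k} {..<k}"

text \<open>In the notation of the English statement, \<open>past k\<close> is F at time
  \<open>k - 1\<close> and \<open>past_graph k\<close> is F' at time \<open>k - 1\<close>. The
  iterates \<open>x k\<close> and \<open>lam k\<close> are known in \<open>past k\<close>; the graph
  used to leave them is known only in \<open>past_graph k\<close>.\<close>

abbreviation past_graph :: "nat \<Rightarrow> 'b measure" where
  "past_graph k \<equiv> info_sigma M A wx wl v {..k} {..<k}"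

abbreviation Abar :: "real^'n^'n" where
  "Abar \<equiv> mean_mat M (A 0)"

text \<open>The sum may run over all agents because, by nonnegativity, an absent link has weight
  zero. The same noisy consensus term drives both updates, which is why \<open>primal_dir\<close>
  contains \<open>dual_dir\<close>.\<close>

definition dual_dir :: "nat \<Rightarrow> 'n \<Rightarrow> 'b \<Rightarrow> 'a" where
  "dual_dir k i \<omega> = (\<Sum>j\<in>UNIV. A k \<omega> $ i $ j *\<^sub>R (x k i \<omega> - x k j \<omega> - wx k i j \<omega>))"

definition primal_dir :: "nat \<Rightarrow> 'n \<Rightarrow> 'b \<Rightarrow> 'a" where
  "primal_dir k i \<omega> = g i (x k i \<omega>) + v k i \<omega>
    + (\<Sum>j\<in>UNIV. A k \<omega> $ i $ j *\<^sub>R (lam k i \<omega> - lam k j \<omega> - wl k i j \<omega>)) + dual_dir k i \<omega>"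

definition V :: "nat \<Rightarrow> 'b \<Rightarrow> real" where
  "V k \<omega> = (\<Sum>i\<in>UNIV. (norm (x k i \<omega> - Xs i))\<^sup>2) + (\<Sum>i\<in>UNIV. (norm (lam k i \<omega> - \<Lambda>s i))\<^sup>2)"

lemmas [measurable] = A_meas wx_meas wl_meas v_meas

lemma Xs_in: "Xs i \<in> \<Omega> i"
  using saddle by (simp add: saddle_point_def)

lemma nonempty: "\<Omega> i \<noteq> {}"
  using Xs_in by blast

lemma sum_neighbours:
  fixes h :: "'n \<Rightarrow> 'a"
  assumes "\<omega> \<in> space M"
  shows "(\<Sum>j\<in>{j. A k \<omega> $ i $ j > 0}. A k \<omega> $ i $ j *\<^sub>R h j) = (\<Sum>j\<in>UNIV. A k \<omega> $ i $ j *\<^sub>R h j)"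
proof (rule sum.mono_neutral_left)
  show "\<forall>j\<in>UNIV - {j. A k \<omega> $ i $ j > 0}. A k \<omega> $ i $ j *\<^sub>R h j = 0"
  proof
    fix j assume "j \<in> UNIV - {j. A k \<omega> $ i $ j > 0}"
    then have "A k \<omega> $ i $ j = 0" using A_nonneg[OF assms, of k i j] by simp
    then show "A k \<omega> $ i $ j *\<^sub>R h j = 0" by simp
  qed
qed auto

lemma x_Suc:
  "\<omega> \<in> space M \<Longrightarrow> x (Suc k) i \<omega> = closest_point (\<Omega> i) (x k i \<omega> - \<gamma> k *\<^sub>R primal_dir k i \<omega>)"
  unfolding primal_dir_def dual_dir_def
  by (simp add: x_step sum_neighbours diff_diff_eq scaleR_add_right add.assoc)

lemma lam_Suc: "\<omega> \<in> space M \<Longrightarrow> lam (Suc k) i \<omega> = lam k i \<omega> + \<gamma> k *\<^sub>R dual_dir k i \<omega>"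
  by (simp add: lam_step sum_neighbours dual_dir_def diff_diff_eq)

lemma x_in: "\<omega> \<in> space M \<Longrightarrow> x (Suc k) i \<omega> \<in> \<Omega> i"
  by (simp add: x_Suc closest_point_in_set closed nonempty)

section \<open>Measurability of the iterates\<close>

lemma subalgebra_info: "subalgebra M (info_sigma M A wx wl v K N)"
  by (rule subalgebra_info_sigma) measurable

lemma past_graph_subalgebra: "subalgebra (past_graph k) (past k)"
  by (rule info_sigma_mono) auto

lemma past_subalgebra: "subalgebra (past (Suc k)) (past k)"
  by (rule info_sigma_mono) auto

lemma sigma_finite_past_graph: "sigma_finite_subalgebra M (past_graph k)"
  by (intro finite_measure_subalgebra_is_sigma_finite finite_measure_subalgebra.intro
      finite_measure_subalgebra_axioms.intro subalgebra_info finite_measure_axioms)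

text \<open>The Lipschitz bound makes \<open>g i\<close> continuous on \<open>\<Omega> i\<close>
  only. Composed with the projection it is continuous everywhere, and it agrees with
  \<open>g i\<close> at every iterate after time 0; the iterate at time 0 is constant.\<close>

lemma gradient_measurable:
  assumes [measurable]: "x k i \<in> borel_measurable N" and "space N = space M"
  shows "(\<lambda>\<omega>. g i (x k i \<omega>)) \<in> borel_measurable N"
proof (cases k)
  case 0
  have "(\<lambda>\<omega>. g i (x k i \<omega>)) \<in> borel_measurable N \<longleftrightarrow> (\<lambda>\<omega>. g i (x0 i)) \<in> borel_measurable N"
    by (rule measurable_cong) (simp add: x_init 0 assms)
  then show ?thesis by simp
next
  case (Suc l)
  have "continuous_on (\<Omega> i) (g i)"
  proof (rule continuous_on_subset[OF lipschitz_on_continuous_on[where L = "\<bar>Lf\<bar>"]])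
    show "\<bar>Lf\<bar>-lipschitz_on (\<Omega> i) (g i)"
    proof (rule lipschitz_onI)
      fix y z assume "y \<in> \<Omega> i" "z \<in> \<Omega> i"
      then have "dist (g i y) (g i z) \<le> Lf * dist y z" using lipschitz by (simp add: dist_norm)
      also have "\<dots> \<le> \<bar>Lf\<bar> * dist y z" by (simp add: mult_right_mono)
      finally show "dist (g i y) (g i z) \<le> \<bar>Lf\<bar> * dist y z" .
    qed simp
  qed simp
  then have "continuous_on UNIV (g i \<circ> closest_point (\<Omega> i))"
    by (intro continuous_on_compose continuous_on_closest_point convex closed nonempty)
      (auto elim!: continuous_on_subset simp: closest_point_in_set closed nonempty)
  then have "g i \<circ> closest_point (\<Omega> i) \<in> borel_measurable borel"
    by (rule borel_measurable_continuous_onI)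
  then have "(\<lambda>\<omega>. (g i \<circ> closest_point (\<Omega> i)) (x k i \<omega>)) \<in> borel_measurable N"
    by measurable
  moreover have "(\<lambda>\<omega>. (g i \<circ> closest_point (\<Omega> i)) (x k i \<omega>)) \<in> borel_measurable N
      \<longleftrightarrow> (\<lambda>\<omega>. g i (x k i \<omega>)) \<in> borel_measurable N"
    by (rule measurable_cong) (simp add: Suc assms x_in closest_point_self)
  ultimately show ?thesis by simp
qed

lemma adapted: "x k i \<in> borel_measurable (past k)" "lam k i \<in> borel_measurable (past k)"
proof (induction k arbitrary: i)
  case 0
  have "x 0 i \<in> borel_measurable (past 0) \<longleftrightarrow> (\<lambda>\<omega>. x0 i) \<in> borel_measurable (past 0)"
    "lam 0 i \<in> borel_measurable (past 0) \<longleftrightarrow> (\<lambda>\<omega>. l0 i) \<in> borel_measurable (past 0)" for i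
    by (rule measurable_cong; simp add: x_init lam_init)+
  then show "x 0 i \<in> borel_measurable (past 0)" "lam 0 i \<in> borel_measurable (past 0)" for i
    by simp_all
next
  case (Suc k)
  have [measurable]: "x k i \<in> borel_measurable (past (Suc k))" "lam k i \<in> borel_measurable (past (Suc k))" for i
    by (rule measurable_from_subalg[OF past_subalgebra Suc.IH(1)],
        rule measurable_from_subalg[OF past_subalgebra Suc.IH(2)])
  have [measurable]: "(\<lambda>\<omega>. g i (x k i \<omega>)) \<in> borel_measurable (past (Suc k))" for i
    by (rule gradient_measurable) simp_all
  have [measurable]: "A k \<in> borel_measurable (past (Suc k))" "wx k i j \<in> borel_measurable (past (Suc k))"
    "wl k i j \<in> borel_measurable (past (Suc k))" "v k i \<in> borel_measurable (past (Suc k))" for i j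
    by (simp_all add: measurable_info_sigma)
  have dual [measurable]: "dual_dir k i \<in> borel_measurable (past (Suc k))" for i
    unfolding dual_dir_def[abs_def] by measurable
  have primal [measurable]: "primal_dir k i \<in> borel_measurable (past (Suc k))" for i
    unfolding primal_dir_def[abs_def] by measurable
  have [measurable]: "closest_point (\<Omega> i) \<in> borel_measurable borel" for i
    by (intro borel_measurable_continuous_onI continuous_on_closest_point convex closed nonempty)
  have "x (Suc k) i \<in> borel_measurable (past (Suc k))
      \<longleftrightarrow> (\<lambda>\<omega>. closest_point (\<Omega> i) (x k i \<omega> - \<gamma> k *\<^sub>R primal_dir k i \<omega>)) \<in> borel_measurable (past (Suc k))"
    "lam (Suc k) i \<in> borel_measurable (past (Suc k))
      \<longleftrightarrow> (\<lambda>\<omega>. lam k i \<omega> + \<gamma> k *\<^sub>R dual_dir k i \<omega>) \<in> borel_measurable (past (Suc k))" for i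
    by (rule measurable_cong; simp add: x_Suc lam_Suc)+
  then show "x (Suc k) i \<in> borel_measurable (past (Suc k))" "lam (Suc k) i \<in> borel_measurable (past (Suc k))" for i
    by simp_all
qed

lemma adapted_gradient: "(\<lambda>\<omega>. g i (x k i \<omega>)) \<in> borel_measurable (past k)"
  by (rule gradient_measurable) (simp_all add: adapted)

lemma measurable_M [measurable]:
  "x k i \<in> borel_measurable M" "lam k i \<in> borel_measurable M"
  "(\<lambda>\<omega>. g i (x k i \<omega>)) \<in> borel_measurable M"
  by (rule measurable_from_subalg[OF subalgebra_info adapted(1)],
      rule measurable_from_subalg[OF subalgebra_info adapted(2)],
      rule measurable_from_subalg[OF subalgebra_info adapted_gradient])

lemma dir_measurable [measurable]:
  "dual_dir k i \<in> borel_measurable M" "primal_dir k i \<in> borel_measurable M"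
  unfolding dual_dir_def[abs_def] primal_dir_def[abs_def] by measurable

lemma V_adapted: "V k \<in> borel_measurable (past k)"
proof -
  have [measurable]: "x k i \<in> borel_measurable (past k)" "lam k i \<in> borel_measurable (past k)" for i
    by (rule adapted)+
  show ?thesis unfolding V_def[abs_def] by measurable
qed

lemma V_measurable [measurable]: "V k \<in> borel_measurable M"
  by (rule measurable_from_subalg[OF subalgebra_info V_adapted])

lemma V_nonneg: "0 \<le> V k \<omega>"
  by (simp add: V_def sum_nonneg)

section \<open>Independence of the current graph from the past\<close>

lemma past_indep: "indep_set {A k -` B \<inter> space M | B. B \<in> sets borel} (sets (past k))"
proof (cases k)
  case 0
  \<comment> \<open>Initial values are deterministic, so nothing is known before time 0: this
    sigma-algebra is trivial and every event is independent of it.\<close>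
  have "sets (past 0) = {{}, space M}"
    by (simp add: sets_info_sigma sigma_sets_empty_eq)
  then show ?thesis
    unfolding 0 indep_sets2_eq using measurable_sets[OF A_meas[of 0]] by (auto simp: prob_space)
qed (simp add: L_indep)

lemma entry_indep:
  fixes h :: "'b \<Rightarrow> 'c::topological_space"
  assumes h: "h \<in> borel_measurable (past k)" and [measurable]: "\<phi> \<in> borel_measurable borel"
  shows "indep_var borel (\<lambda>\<omega>. \<phi> (A k \<omega> $ i $ j)) borel h"
  by (rule indep_var_of_indep_set[OF A_meas subalgebra_info past_indep _ h, of "\<lambda>B. \<phi> (B $ i $ j)"]) measurable

text \<open>A random weight multiplying a quantity known from the past costs only the factor
  \<open>\<eta>\<^sup>2\<close>. Second moments of the weights suffice because independence factors
  the integral.\<close>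

lemma nn_integral_entry_sq:
  fixes h :: "'b \<Rightarrow> ennreal"
  assumes "h \<in> borel_measurable (past k)"
  shows "(\<integral>\<^sup>+\<omega>. ennreal ((A k \<omega> $ i $ j)\<^sup>2) * h \<omega> \<partial>M) \<le> ennreal (\<eta>\<^sup>2) * (\<integral>\<^sup>+\<omega>. h \<omega> \<partial>M)"
proof -
  have "(\<integral>\<^sup>+\<omega>. ennreal ((A k \<omega> $ i $ j)\<^sup>2) * h \<omega> \<partial>M)
      = (\<integral>\<^sup>+\<omega>. ennreal ((A k \<omega> $ i $ j)\<^sup>2) \<partial>M) * (\<integral>\<^sup>+\<omega>. h \<omega> \<partial>M)"
    by (rule indep_var_nn_integral, rule entry_indep[OF assms]) measurable
  then show ?thesis by (simp add: mult_right_mono A_second)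
qed

lemma entry_sq_integrable: "integrable M (\<lambda>\<omega>. (A k \<omega> $ i $ j)\<^sup>2)"
  by (rule integrableI_bounded) (use A_second[of k i j] in \<open>auto intro: le_less_trans\<close>)

lemma entry_integrable: "integrable M (\<lambda>\<omega>. A k \<omega> $ i $ j)"
  by (rule square_integrable_imp_integrable[OF _ entry_sq_integrable]) measurable

lemma entry_mean: "(\<integral>\<omega>. A k \<omega> $ i $ j \<partial>M) = Abar $ i $ j"
proof -
  have "(\<integral>\<omega>. A k \<omega> $ i $ j \<partial>M) = (\<integral>B. B $ i $ j \<partial>distr M borel (A k))" for k
    by (subst integral_distr) auto
  then show ?thesis by (simp add: A_ident[of k] mean_mat_def)
qed

lemma Abar_nonneg: "0 \<le> Abar $ i $ j"
  unfolding entry_mean[of 0, symmetric] by (intro integral_nonneg_AE AE_I2 A_nonneg)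

text \<open>The Laplacian is linear in the entries, so the saddle point hypothesis about the mean of
  the Laplacians becomes one about the symmetric nonnegative matrix \<open>Abar\<close>.\<close>

lemma mean_laplacian: "mean_mat M (\<lambda>\<omega>. laplacian (A 0 \<omega>)) = laplacian Abar"
  by (simp add: vec_eq_iff mean_mat_def laplacian_def entry_integrable)

lemma entry_times_integral:
  fixes h :: "'b \<Rightarrow> real"
  assumes "h \<in> borel_measurable (past k)" "integrable M h"
  shows "has_bochner_integral M (\<lambda>\<omega>. A k \<omega> $ i $ j * h \<omega>) (Abar $ i $ j * (\<integral>\<omega>. h \<omega> \<partial>M))"
proof -
  have indep: "indep_var borel (\<lambda>\<omega>. A k \<omega> $ i $ j) borel h"
    using entry_indep[OF assms(1), of "\<lambda>a. a"] by simp
  show ?thesis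
    unfolding has_bochner_integral_iff
    using indep_var_integrable[OF indep entry_integrable assms(2)]
      indep_var_lebesgue_integral[OF indep entry_integrable assms(2)]
    by (simp add: entry_mean)
qed

section \<open>Second moments relative to \<open>1 + V\<close>\<close>

text \<open>The conditional bound \<open>E[\<parallel>u\<^sub>k\<parallel>\<^sup>2 | past k] \<le> C (1 + V\<^sub>k)\<close> in integrated form, with \<open>C\<close> independent of \<open>k\<close>.\<close>
definition square_dominated :: "(nat \<Rightarrow> 'b \<Rightarrow> 'a) \<Rightarrow> bool" where
  "square_dominated u \<longleftrightarrow> (\<forall>k. u k \<in> borel_measurable M) \<and>
    (\<exists>C<\<top>. \<forall>k. \<forall>B\<in>sets (past k). (\<integral>\<^sup>+\<omega>\<in>B. ennreal ((norm (u k \<omega>))\<^sup>2) \<partial>M)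
      \<le> C * (\<integral>\<^sup>+\<omega>\<in>B. ennreal (1 + V k \<omega>) \<partial>M))"

lemma square_dominatedI:
  assumes "\<And>k. u k \<in> borel_measurable M" "C < \<top>"
    and "\<And>k B. B \<in> sets (past k) \<Longrightarrow> (\<integral>\<^sup>+\<omega>\<in>B. ennreal ((norm (u k \<omega>))\<^sup>2) \<partial>M)
      \<le> C * (\<integral>\<^sup>+\<omega>\<in>B. ennreal (1 + V k \<omega>) \<partial>M)"
  shows "square_dominated u"
  using assms unfolding square_dominated_def by blast

lemma square_dominatedE:
  assumes "square_dominated u"
  obtains C where "C < \<top>" "\<And>k. u k \<in> borel_measurable M"
    "\<And>k B. B \<in> sets (past k) \<Longrightarrow> (\<integral>\<^sup>+\<omega>\<in>B. ennreal ((norm (u k \<omega>))\<^sup>2) \<partial>M)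
      \<le> C * (\<integral>\<^sup>+\<omega>\<in>B. ennreal (1 + V k \<omega>) \<partial>M)"
  using assms unfolding square_dominated_def by blast

lemma past_sets: "B \<in> sets (past k) \<Longrightarrow> B \<in> sets M"
  using subalgebra_info by (auto simp: subalgebra_def)

lemma square_dominated_bound:
  assumes "\<And>k. u k \<in> borel_measurable M" and c: "0 \<le> c"
    and le: "\<And>k \<omega>. \<omega> \<in> space M \<Longrightarrow> (norm (u k \<omega>))\<^sup>2 \<le> c * (1 + V k \<omega>)"
  shows "square_dominated u"
proof (rule square_dominatedI)
  fix k B assume "B \<in> sets (past k)"
  then have [measurable]: "B \<in> sets M" by (rule past_sets)
  have "(\<integral>\<^sup>+\<omega>\<in>B. ennreal ((norm (u k \<omega>))\<^sup>2) \<partial>M) \<le> (\<integral>\<^sup>+\<omega>\<in>B. ennreal c * ennreal (1 + V k \<omega>) \<partial>M)"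
    by (intro nn_integral_mono mult_right_mono)
      (simp_all add: ennreal_mult[symmetric] c V_nonneg le ennreal_leI del: ennreal_plus)
  also have "\<dots> = ennreal c * (\<integral>\<^sup>+\<omega>\<in>B. ennreal (1 + V k \<omega>) \<partial>M)"
    by (simp add: mult.assoc nn_integral_cmult)
  finally show "(\<integral>\<^sup>+\<omega>\<in>B. ennreal ((norm (u k \<omega>))\<^sup>2) \<partial>M) \<le> ennreal c * (\<integral>\<^sup>+\<omega>\<in>B. ennreal (1 + V k \<omega>) \<partial>M)" .
qed (simp_all add: assms)

lemma square_dominated_add:
  assumes "square_dominated u" "square_dominated w"
  shows "square_dominated (\<lambda>k \<omega>. u k \<omega> + w k \<omega>)"
proof -
  obtain C where C: "C < \<top>" and [measurable]: "\<And>k. u k \<in> borel_measurable M"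
    and u: "\<And>k B. B \<in> sets (past k) \<Longrightarrow> (\<integral>\<^sup>+\<omega>\<in>B. ennreal ((norm (u k \<omega>))\<^sup>2) \<partial>M)
      \<le> C * (\<integral>\<^sup>+\<omega>\<in>B. ennreal (1 + V k \<omega>) \<partial>M)"
    by (rule square_dominatedE[OF assms(1)]) (rule that)
  obtain D where D: "D < \<top>" and [measurable]: "\<And>k. w k \<in> borel_measurable M"
    and w: "\<And>k B. B \<in> sets (past k) \<Longrightarrow> (\<integral>\<^sup>+\<omega>\<in>B. ennreal ((norm (w k \<omega>))\<^sup>2) \<partial>M)
      \<le> D * (\<integral>\<^sup>+\<omega>\<in>B. ennreal (1 + V k \<omega>) \<partial>M)"
    by (rule square_dominatedE[OF assms(2)]) (rule that)
  show ?thesis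
  proof (rule square_dominatedI)
    fix k B assume B: "B \<in> sets (past k)"
    then have [measurable]: "B \<in> sets M" by (rule past_sets)
    have "(\<integral>\<^sup>+\<omega>\<in>B. ennreal ((norm (u k \<omega> + w k \<omega>))\<^sup>2) \<partial>M)
        \<le> (\<integral>\<^sup>+\<omega>. 2 * (ennreal ((norm (u k \<omega>))\<^sup>2) * indicator B \<omega>)
          + 2 * (ennreal ((norm (w k \<omega>))\<^sup>2) * indicator B \<omega>) \<partial>M)"
    proof (rule nn_integral_mono)
      fix \<omega>
      have "ennreal ((norm (u k \<omega> + w k \<omega>))\<^sup>2) \<le> ennreal (2 * (norm (u k \<omega>))\<^sup>2 + 2 * (norm (w k \<omega>))\<^sup>2)"
        by (intro ennreal_leI norm_add_power2_le)
      also have "\<dots> = 2 * ennreal ((norm (u k \<omega>))\<^sup>2) + 2 * ennreal ((norm (w k \<omega>))\<^sup>2)"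
        by (simp add: ennreal_mult)
      finally show "ennreal ((norm (u k \<omega> + w k \<omega>))\<^sup>2) * indicator B \<omega>
          \<le> 2 * (ennreal ((norm (u k \<omega>))\<^sup>2) * indicator B \<omega>) + 2 * (ennreal ((norm (w k \<omega>))\<^sup>2) * indicator B \<omega>)"
        by (simp split: split_indicator)
    qed
    also have "\<dots> = 2 * (\<integral>\<^sup>+\<omega>\<in>B. ennreal ((norm (u k \<omega>))\<^sup>2) \<partial>M) + 2 * (\<integral>\<^sup>+\<omega>\<in>B. ennreal ((norm (w k \<omega>))\<^sup>2) \<partial>M)"
      by (subst nn_integral_add) (simp_all add: nn_integral_cmult)
    also have "\<dots> \<le> 2 * (C * (\<integral>\<^sup>+\<omega>\<in>B. ennreal (1 + V k \<omega>) \<partial>M)) + 2 * (D * (\<integral>\<^sup>+\<omega>\<in>B. ennreal (1 + V k \<omega>) \<partial>M))"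
      by (intro add_mono mult_left_mono u w B) simp_all
    also have "\<dots> = (2 * C + 2 * D) * (\<integral>\<^sup>+\<omega>\<in>B. ennreal (1 + V k \<omega>) \<partial>M)"
      by (simp add: distrib_right mult.assoc)
    finally show "(\<integral>\<^sup>+\<omega>\<in>B. ennreal ((norm (u k \<omega> + w k \<omega>))\<^sup>2) \<partial>M)
        \<le> (2 * C + 2 * D) * (\<integral>\<^sup>+\<omega>\<in>B. ennreal (1 + V k \<omega>) \<partial>M)" .
  qed (use C D in \<open>auto simp: ennreal_mult_less_top\<close>)
qed

lemma square_dominated_diff:
  assumes "square_dominated u" "square_dominated w"
  shows "square_dominated (\<lambda>k \<omega>. u k \<omega> - w k \<omega>)"
proof -
  have "square_dominated (\<lambda>k \<omega>. - w k \<omega>)"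
    using assms(2) by (simp add: square_dominated_def)
  from square_dominated_add[OF assms(1) this] show ?thesis by simp
qed

lemma square_dominated_const: "square_dominated (\<lambda>k \<omega>. c)"
  by (rule square_dominated_bound[where c = "(norm c)\<^sup>2"]) (auto simp: V_nonneg mult_le_cancel_left1)

lemma square_dominated_sum:
  assumes "finite J" "\<And>j. j \<in> J \<Longrightarrow> square_dominated (u j)"
  shows "square_dominated (\<lambda>k \<omega>. \<Sum>j\<in>J. u j k \<omega>)"
  using assms by (induction J rule: finite_induct) (auto intro: square_dominated_add square_dominated_const)

lemma deviation_le_V:
  "(norm (x k i \<omega> - Xs i))\<^sup>2 \<le> V k \<omega>" "(norm (lam k i \<omega> - \<Lambda>s i))\<^sup>2 \<le> V k \<omega>"
proof -
  have "(norm (x k i \<omega> - Xs i))\<^sup>2 \<le> (\<Sum>i\<in>UNIV. (norm (x k i \<omega> - Xs i))\<^sup>2)"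
    "(norm (lam k i \<omega> - \<Lambda>s i))\<^sup>2 \<le> (\<Sum>i\<in>UNIV. (norm (lam k i \<omega> - \<Lambda>s i))\<^sup>2)"
    by (rule member_le_sum; simp)+
  moreover have "0 \<le> (\<Sum>i\<in>UNIV. (norm (x k i \<omega> - Xs i))\<^sup>2)"
    "0 \<le> (\<Sum>i\<in>UNIV. (norm (lam k i \<omega> - \<Lambda>s i))\<^sup>2)" by (simp_all add: sum_nonneg)
  ultimately show "(norm (x k i \<omega> - Xs i))\<^sup>2 \<le> V k \<omega>" "(norm (lam k i \<omega> - \<Lambda>s i))\<^sup>2 \<le> V k \<omega>"
    unfolding V_def by linarith+
qed

lemma square_dominated_deviation:
  "square_dominated (\<lambda>k \<omega>. x k i \<omega> - Xs i)" "square_dominated (\<lambda>k \<omega>. lam k i \<omega> - \<Lambda>s i)"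
  by (rule square_dominated_bound[where c = 1]; use deviation_le_V in \<open>auto intro: add_increasing\<close>)+

lemma square_dominated_state:
  "square_dominated (\<lambda>k. x k i)" "square_dominated (\<lambda>k. lam k i)"
  using square_dominated_add[OF square_dominated_deviation(1) square_dominated_const, of i "Xs i"]
    square_dominated_add[OF square_dominated_deviation(2) square_dominated_const, of i "\<Lambda>s i"]
  by simp_all

lemma square_dominated_gradient: "square_dominated (\<lambda>k \<omega>. g i (x k i \<omega>))"
proof (rule square_dominated_bound[where c = "2 * Lf\<^sup>2 + 2 * (norm (g i (Xs i)))\<^sup>2 + (norm (g i (x0 i)))\<^sup>2"])
  fix k \<omega> assume \<omega>: "\<omega> \<in> space M"
  have le: "(norm (g i (x k i \<omega>)))\<^sup>2
      \<le> 2 * Lf\<^sup>2 * V k \<omega> + 2 * (norm (g i (Xs i)))\<^sup>2 + (norm (g i (x0 i)))\<^sup>2"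
  proof (cases k)
    case 0
    then show ?thesis using \<omega> by (simp add: x_init V_nonneg)
  next
    case (Suc l)
    have "(norm (g i (x k i \<omega>)))\<^sup>2
        \<le> 2 * (norm (g i (x k i \<omega>) - g i (Xs i)))\<^sup>2 + 2 * (norm (g i (Xs i)))\<^sup>2"
      using norm_add_power2_le[of "g i (x k i \<omega>) - g i (Xs i)" "g i (Xs i)"] by simp
    also have "(norm (g i (x k i \<omega>) - g i (Xs i)))\<^sup>2 \<le> (Lf * norm (x k i \<omega> - Xs i))\<^sup>2"
      using \<omega> by (intro power_mono lipschitz Xs_in) (auto simp: Suc x_in)
    also have "\<dots> \<le> Lf\<^sup>2 * V k \<omega>"
      by (simp add: power_mult_distrib mult_left_mono deviation_le_V)
    finally show ?thesis by (simp add: mult.assoc add_increasing2)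
  qed
  have "0 \<le> 2 * Lf\<^sup>2 + (2 * (norm (g i (Xs i)))\<^sup>2 + (norm (g i (x0 i)))\<^sup>2) * V k \<omega>"
    by (simp add: V_nonneg)
  with le show "(norm (g i (x k i \<omega>)))\<^sup>2
      \<le> (2 * Lf\<^sup>2 + 2 * (norm (g i (Xs i)))\<^sup>2 + (norm (g i (x0 i)))\<^sup>2) * (1 + V k \<omega>)"
    by (simp add: algebra_simps)
qed simp_all

lemma square_dominated_entry:
  assumes "square_dominated u" and adapted_u: "\<And>k. u k \<in> borel_measurable (past k)"
  shows "square_dominated (\<lambda>k \<omega>. A k \<omega> $ i $ j *\<^sub>R u k \<omega>)"
proof -
  obtain C where C: "C < \<top>" and [measurable]: "\<And>k. u k \<in> borel_measurable M"
    and u: "\<And>k B. B \<in> sets (past k) \<Longrightarrow> (\<integral>\<^sup>+\<omega>\<in>B. ennreal ((norm (u k \<omega>))\<^sup>2) \<partial>M)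
      \<le> C * (\<integral>\<^sup>+\<omega>\<in>B. ennreal (1 + V k \<omega>) \<partial>M)"
    by (rule square_dominatedE[OF assms(1)]) (rule that)
  show ?thesis
  proof (rule square_dominatedI)
    fix k B assume B [measurable]: "B \<in> sets (past k)"
    have [measurable]: "u k \<in> borel_measurable (past k)" by (rule adapted_u)
    have "(\<integral>\<^sup>+\<omega>\<in>B. ennreal ((norm (A k \<omega> $ i $ j *\<^sub>R u k \<omega>))\<^sup>2) \<partial>M)
        = (\<integral>\<^sup>+\<omega>. ennreal ((A k \<omega> $ i $ j)\<^sup>2) * (ennreal ((norm (u k \<omega>))\<^sup>2) * indicator B \<omega>) \<partial>M)"
      by (simp add: power_mult_distrib ennreal_mult mult.assoc)
    also have "\<dots> \<le> ennreal (\<eta>\<^sup>2) * (\<integral>\<^sup>+\<omega>\<in>B. ennreal ((norm (u k \<omega>))\<^sup>2) \<partial>M)"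
      by (rule nn_integral_entry_sq) measurable
    also have "\<dots> \<le> ennreal (\<eta>\<^sup>2) * C * (\<integral>\<^sup>+\<omega>\<in>B. ennreal (1 + V k \<omega>) \<partial>M)"
      unfolding mult.assoc by (intro mult_left_mono u B) simp
    finally show "(\<integral>\<^sup>+\<omega>\<in>B. ennreal ((norm (A k \<omega> $ i $ j *\<^sub>R u k \<omega>))\<^sup>2) \<partial>M)
        \<le> ennreal (\<eta>\<^sup>2) * C * (\<integral>\<^sup>+\<omega>\<in>B. ennreal (1 + V k \<omega>) \<partial>M)" .
  qed (use C in \<open>auto simp: ennreal_mult_less_top\<close>)
qed

lemma nn_integral_cond_bound:
  fixes h w b :: "'b \<Rightarrow> ennreal"
  assumes "h \<in> borel_measurable (past_graph k)" "w \<in> borel_measurable M"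
    and "AE \<omega> in M. nn_cond_exp M (past_graph k) w \<omega> \<le> b \<omega>"
  shows "(\<integral>\<^sup>+\<omega>. h \<omega> * w \<omega> \<partial>M) \<le> (\<integral>\<^sup>+\<omega>. h \<omega> * b \<omega> \<partial>M)"
proof -
  interpret P: sigma_finite_subalgebra M "past_graph k" by (rule sigma_finite_past_graph)
  have "(\<integral>\<^sup>+\<omega>. h \<omega> * w \<omega> \<partial>M) = (\<integral>\<^sup>+\<omega>. h \<omega> * nn_cond_exp M (past_graph k) w \<omega> \<partial>M)"
    by (rule P.nn_cond_exp_intg[symmetric]) (use assms in auto)
  also have "\<dots> \<le> (\<integral>\<^sup>+\<omega>. h \<omega> * b \<omega> \<partial>M)"
    by (rule nn_integral_mono_AE) (use assms(3) in \<open>auto elim!: eventually_mono intro: mult_left_mono\<close>)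
  finally show ?thesis .
qed

lemma past_sets_graph: "B \<in> sets (past k) \<Longrightarrow> B \<in> sets (past_graph k)"
  using past_graph_subalgebra by (auto simp: subalgebra_def)

text \<open>The order matters. Conditioning on \<open>past_graph k\<close> treats the weight as
  known and replaces the squared noise by \<open>\<mu>\<^sup>2\<close>; only then does independence
  from \<open>past k\<close> replace the squared weight by \<open>\<eta>\<^sup>2\<close>. Reversing
  it would require the weight and the noise to be independent.\<close>

lemma square_dominated_entry_noise:
  assumes [measurable]: "\<And>k. w k \<in> borel_measurable M"
    and var: "\<And>k. AE \<omega> in M. nn_cond_exp M (past_graph k) (\<lambda>\<omega>. ennreal ((norm (w k \<omega>))\<^sup>2)) \<omega> \<le> ennreal (\<mu>\<^sup>2)"
  shows "square_dominated (\<lambda>k \<omega>. A k \<omega> $ i $ j *\<^sub>R w k \<omega>)"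
proof (rule square_dominatedI)
  fix k B assume B: "B \<in> sets (past k)"
  then have [measurable]: "B \<in> sets M" "B \<in> sets (past_graph k)"
    by (rule past_sets, rule past_sets_graph)
  have [measurable]: "A k \<in> borel_measurable (past_graph k)" by (simp add: measurable_info_sigma)
  have "(\<integral>\<^sup>+\<omega>\<in>B. ennreal ((norm (A k \<omega> $ i $ j *\<^sub>R w k \<omega>))\<^sup>2) \<partial>M)
      = (\<integral>\<^sup>+\<omega>. (ennreal ((A k \<omega> $ i $ j)\<^sup>2) * indicator B \<omega>) * ennreal ((norm (w k \<omega>))\<^sup>2) \<partial>M)"
    by (simp add: power_mult_distrib ennreal_mult ac_simps)
  also have "\<dots> \<le> (\<integral>\<^sup>+\<omega>. (ennreal ((A k \<omega> $ i $ j)\<^sup>2) * indicator B \<omega>) * ennreal (\<mu>\<^sup>2) \<partial>M)"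
    by (rule nn_integral_cond_bound) (use var in measurable)
  also have "\<dots> = ennreal (\<mu>\<^sup>2) * (\<integral>\<^sup>+\<omega>. ennreal ((A k \<omega> $ i $ j)\<^sup>2) * indicator B \<omega> \<partial>M)"
    by (subst nn_integral_multc) (simp_all add: mult.commute)
  also have "\<dots> \<le> ennreal (\<mu>\<^sup>2) * (ennreal (\<eta>\<^sup>2) * (\<integral>\<^sup>+\<omega>. indicator B \<omega> \<partial>M))"
    by (intro mult_left_mono nn_integral_entry_sq) (use B in auto)
  also have "\<dots> \<le> ennreal (\<mu>\<^sup>2) * (ennreal (\<eta>\<^sup>2) * (\<integral>\<^sup>+\<omega>\<in>B. ennreal (1 + V k \<omega>) \<partial>M))"
    by (intro mult_left_mono nn_integral_mono) (auto simp: V_nonneg split: split_indicator)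
  finally show "(\<integral>\<^sup>+\<omega>\<in>B. ennreal ((norm (A k \<omega> $ i $ j *\<^sub>R w k \<omega>))\<^sup>2) \<partial>M)
      \<le> ennreal (\<mu>\<^sup>2) * ennreal (\<eta>\<^sup>2) * (\<integral>\<^sup>+\<omega>\<in>B. ennreal (1 + V k \<omega>) \<partial>M)"
    by (simp add: mult.assoc)
qed (auto simp: ennreal_mult_less_top)

text \<open>The variance bound grows with the iterate, which is itself dominated by
  \<open>1 + V\<close>; the constant of \<open>x k i\<close> therefore enters.\<close>

lemma square_dominated_v: "square_dominated (\<lambda>k. v k i)"
proof -
  obtain C where C: "C < \<top>" and "\<And>k. x k i \<in> borel_measurable M"
    and x: "\<And>k B. B \<in> sets (past k) \<Longrightarrow> (\<integral>\<^sup>+\<omega>\<in>B. ennreal ((norm (x k i \<omega>))\<^sup>2) \<partial>M)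
      \<le> C * (\<integral>\<^sup>+\<omega>\<in>B. ennreal (1 + V k \<omega>) \<partial>M)"
    by (rule square_dominatedE[OF square_dominated_state(1)[of i]]) (rule that)
  show ?thesis
  proof (rule square_dominatedI)
    fix k B assume B: "B \<in> sets (past k)"
    then have [measurable]: "B \<in> sets M" "B \<in> sets (past_graph k)"
      by (rule past_sets, rule past_sets_graph)
    have "(\<integral>\<^sup>+\<omega>\<in>B. ennreal ((norm (v k i \<omega>))\<^sup>2) \<partial>M)
        = (\<integral>\<^sup>+\<omega>. indicator B \<omega> * ennreal ((norm (v k i \<omega>))\<^sup>2) \<partial>M)"
      by (simp add: mult.commute)
    also have "\<dots> \<le> (\<integral>\<^sup>+\<omega>. indicator B \<omega> * ennreal (cv * (1 + (norm (x k i \<omega>))\<^sup>2)) \<partial>M)"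
      by (rule nn_integral_cond_bound[OF _ _ v_var]) measurable
    also have "\<dots> = (\<integral>\<^sup>+\<omega>. ennreal cv * (indicator B \<omega> + ennreal ((norm (x k i \<omega>))\<^sup>2) * indicator B \<omega>) \<partial>M)"
      by (rule nn_integral_cong) (auto simp: ennreal_mult cv_nonneg split: split_indicator)
    also have "\<dots> = ennreal cv * ((\<integral>\<^sup>+\<omega>. indicator B \<omega> \<partial>M) + (\<integral>\<^sup>+\<omega>\<in>B. ennreal ((norm (x k i \<omega>))\<^sup>2) \<partial>M))"
      by (simp add: nn_integral_cmult nn_integral_add)
    also have "\<dots> \<le> ennreal cv * ((\<integral>\<^sup>+\<omega>\<in>B. ennreal (1 + V k \<omega>) \<partial>M) + C * (\<integral>\<^sup>+\<omega>\<in>B. ennreal (1 + V k \<omega>) \<partial>M))"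
      by (intro mult_left_mono add_mono x B nn_integral_mono) (auto simp: V_nonneg split: split_indicator)
    also have "\<dots> = ennreal cv * (1 + C) * (\<integral>\<^sup>+\<omega>\<in>B. ennreal (1 + V k \<omega>) \<partial>M)"
      by (simp add: distrib_right distrib_left mult.assoc)
    finally show "(\<integral>\<^sup>+\<omega>\<in>B. ennreal ((norm (v k i \<omega>))\<^sup>2) \<partial>M)
        \<le> ennreal cv * (1 + C) * (\<integral>\<^sup>+\<omega>\<in>B. ennreal (1 + V k \<omega>) \<partial>M)" .
  qed (use C in \<open>auto simp: ennreal_mult_less_top\<close>)
qed

lemma square_dominated_dir:
  "square_dominated (\<lambda>k. dual_dir k i)" "square_dominated (\<lambda>k. primal_dir k i)"
proof -
  \<comment> \<open>Each summand splits into weight times signal, where the signal is known from the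
    past, and weight times noise, which is centred given the weight.\<close>
  have "square_dominated (\<lambda>k \<omega>. A k \<omega> $ i $ j *\<^sub>R (x k i \<omega> - x k j \<omega> - wx k i j \<omega>))"
    "square_dominated (\<lambda>k \<omega>. A k \<omega> $ i $ j *\<^sub>R (lam k i \<omega> - lam k j \<omega> - wl k i j \<omega>))" for i j
    unfolding scaleR_diff_right[of _ "_ - _"]
    by (intro square_dominated_diff square_dominated_entry square_dominated_entry_noise
        square_dominated_state borel_measurable_diff adapted wx_meas wl_meas wx_var wl_var)+
  then show "square_dominated (\<lambda>k. dual_dir k i)" "square_dominated (\<lambda>k. primal_dir k i)"
    unfolding primal_dir_def[abs_def] dual_dir_def[abs_def]
    by (intro square_dominated_add square_dominated_sum square_dominated_gradient square_dominated_v finite; blast)+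
qed

text \<open>The domination is tested on the whole space.\<close>

lemma square_dominated_integrable:
  assumes "square_dominated u" "integrable M (V k)"
  shows "integrable M (\<lambda>\<omega>. (norm (u k \<omega>))\<^sup>2)"
proof -
  obtain C where C: "C < \<top>" and [measurable]: "\<And>k. u k \<in> borel_measurable M"
    and u: "\<And>k B. B \<in> sets (past k) \<Longrightarrow> (\<integral>\<^sup>+\<omega>\<in>B. ennreal ((norm (u k \<omega>))\<^sup>2) \<partial>M)
      \<le> C * (\<integral>\<^sup>+\<omega>\<in>B. ennreal (1 + V k \<omega>) \<partial>M)"
    by (rule square_dominatedE[OF assms(1)]) (rule that)
  have "space M \<in> sets (past k)" using sets.top[of "past k"] by simp
  from u[OF this] have "(\<integral>\<^sup>+\<omega>. ennreal ((norm (u k \<omega>))\<^sup>2) \<partial>M) \<le> C * (\<integral>\<^sup>+\<omega>. ennreal (1 + V k \<omega>) \<partial>M)"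
    by (simp cong: nn_integral_cong_simp)
  also have "(\<integral>\<^sup>+\<omega>. ennreal (1 + V k \<omega>) \<partial>M) = ennreal (\<integral>\<omega>. 1 + V k \<omega> \<partial>M)"
    by (rule nn_integral_eq_integral) (use assms(2) V_nonneg in auto)
  also have "C * \<dots> < \<infinity>" using C by (simp add: ennreal_mult_less_top)
  finally show ?thesis by (intro integrableI_bounded) auto
qed

section \<open>One-step inequality and integrability of \<open>V\<close>\<close>

lemma x_Suc_deviation_le:
  assumes "\<omega> \<in> space M"
  shows "(norm (x (Suc k) i \<omega> - Xs i))\<^sup>2 \<le> (norm (x k i \<omega> - Xs i - \<gamma> k *\<^sub>R primal_dir k i \<omega>))\<^sup>2"
proof -
  have "dist (x (Suc k) i \<omega>) (closest_point (\<Omega> i) (Xs i)) \<le> dist (x k i \<omega> - \<gamma> k *\<^sub>R primal_dir k i \<omega>) (Xs i)"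
    unfolding x_Suc[OF assms] by (intro closest_point_lipschitz convex closed nonempty)
  then have "norm (x (Suc k) i \<omega> - Xs i) \<le> norm (x k i \<omega> - Xs i - \<gamma> k *\<^sub>R primal_dir k i \<omega>)"
    by (simp add: closest_point_self Xs_in dist_norm algebra_simps)
  then show ?thesis by (simp add: power_mono)
qed

text \<open>The first-order part of the expansion of \<open>V (Suc k)\<close>. The dual part has the
  opposite sign because the multipliers move along \<open>dual_dir\<close>, while the iterates move
  against \<open>primal_dir\<close>.\<close>

definition drift :: "nat \<Rightarrow> 'b \<Rightarrow> real" where
  "drift k \<omega> = (\<Sum>i\<in>UNIV. (x k i \<omega> - Xs i) \<bullet> primal_dir k i \<omega> - (lam k i \<omega> - \<Lambda>s i) \<bullet> dual_dir k i \<omega>)"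

definition dir_sq :: "nat \<Rightarrow> 'b \<Rightarrow> real" where
  "dir_sq k \<omega> = (\<Sum>i\<in>UNIV. (norm (primal_dir k i \<omega>))\<^sup>2 + (norm (dual_dir k i \<omega>))\<^sup>2)"

lemma V_Suc_le:
  assumes "\<omega> \<in> space M"
  shows "V (Suc k) \<omega> \<le> V k \<omega> - 2 * \<gamma> k * drift k \<omega> + (\<gamma> k)\<^sup>2 * dir_sq k \<omega>"
proof -
  have expand: "(norm (a - c *\<^sub>R s))\<^sup>2 = (norm a)\<^sup>2 - 2 * c * (a \<bullet> s) + c\<^sup>2 * (norm s)\<^sup>2" for a s :: 'a and c
    unfolding power2_norm_eq_inner
    by (simp add: inner_diff_left inner_diff_right inner_commute power2_eq_square algebra_simps)
  have "(norm (x (Suc k) i \<omega> - Xs i))\<^sup>2 + (norm (lam (Suc k) i \<omega> - \<Lambda>s i))\<^sup>2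
      \<le> (norm (x k i \<omega> - Xs i))\<^sup>2 + (norm (lam k i \<omega> - \<Lambda>s i))\<^sup>2
        - 2 * \<gamma> k * ((x k i \<omega> - Xs i) \<bullet> primal_dir k i \<omega> - (lam k i \<omega> - \<Lambda>s i) \<bullet> dual_dir k i \<omega>)
        + (\<gamma> k)\<^sup>2 * ((norm (primal_dir k i \<omega>))\<^sup>2 + (norm (dual_dir k i \<omega>))\<^sup>2)" for i
  proof -
    \<comment> \<open>Written with \<open>- \<gamma> k\<close> so that one expansion serves both
      updates.\<close>
    have "lam (Suc k) i \<omega> - \<Lambda>s i = (lam k i \<omega> - \<Lambda>s i) - (- \<gamma> k) *\<^sub>R dual_dir k i \<omega>"
      using lam_Suc[OF assms] by simp
    then have "(norm (lam (Suc k) i \<omega> - \<Lambda>s i))\<^sup>2 = (norm (lam k i \<omega> - \<Lambda>s i))\<^sup>2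
        - 2 * (- \<gamma> k) * ((lam k i \<omega> - \<Lambda>s i) \<bullet> dual_dir k i \<omega>) + (- \<gamma> k)\<^sup>2 * (norm (dual_dir k i \<omega>))\<^sup>2"
      by (simp only: expand)
    with x_Suc_deviation_le[OF assms, of k i, unfolded expand] show ?thesis
      by (simp add: algebra_simps)
  qed
  then have "(\<Sum>i\<in>UNIV. (norm (x (Suc k) i \<omega> - Xs i))\<^sup>2 + (norm (lam (Suc k) i \<omega> - \<Lambda>s i))\<^sup>2)
    \<le> (\<Sum>i\<in>UNIV. (norm (x k i \<omega> - Xs i))\<^sup>2 + (norm (lam k i \<omega> - \<Lambda>s i))\<^sup>2
        - 2 * \<gamma> k * ((x k i \<omega> - Xs i) \<bullet> primal_dir k i \<omega> - (lam k i \<omega> - \<Lambda>s i) \<bullet> dual_dir k i \<omega>)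
        + (\<gamma> k)\<^sup>2 * ((norm (primal_dir k i \<omega>))\<^sup>2 + (norm (dual_dir k i \<omega>))\<^sup>2))"
    by (rule sum_mono)
  then show ?thesis
    unfolding V_def drift_def dir_sq_def
    by (simp add: sum.distrib sum_subtractf sum_distrib_left right_diff_distrib distrib_left)
qed

text \<open>There is no circularity: the dominations hold whether or not \<open>V k\<close> is
  integrable. Once \<open>V k\<close> is, all directions at time \<open>k\<close> are square
  integrable, and so the pathwise bound on \<open>V (Suc k)\<close> is integrable.\<close>

lemma V_integrable: "integrable M (V k)"
proof (induction k)
  case 0
  have "integrable M (V 0) \<longleftrightarrow> integrable M (\<lambda>\<omega>. (\<Sum>i\<in>UNIV. (norm (x0 i - Xs i))\<^sup>2) + (\<Sum>i\<in>UNIV. (norm (l0 i - \<Lambda>s i))\<^sup>2))"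
    by (rule Bochner_Integration.integrable_cong) (auto simp: V_def x_init lam_init)
  then show ?case by simp
next
  case (Suc k)
  note sq = square_dominated_integrable[OF _ Suc]
  have "integrable M (drift k)"
    unfolding drift_def[abs_def]
    by (intro Bochner_Integration.integrable_sum Bochner_Integration.integrable_diff
        integrable_inner_of_squares sq square_dominated_deviation[THEN sq] square_dominated_dir[THEN sq]
        borel_measurable_diff borel_measurable_const measurable_M dir_measurable)
  moreover have "integrable M (dir_sq k)"
    unfolding dir_sq_def[abs_def]
    by (intro Bochner_Integration.integrable_sum Bochner_Integration.integrable_add square_dominated_dir[THEN sq])
  ultimately have "integrable M (\<lambda>\<omega>. V k \<omega> - 2 * \<gamma> k * drift k \<omega> + (\<gamma> k)\<^sup>2 * dir_sq k \<omega>)"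
    using Suc by simp
  then show ?case
    by (rule Bochner_Integration.integrable_bound) (auto simp: V_nonneg intro!: AE_I2 order_trans[OF V_Suc_le abs_ge_self])
qed

lemmas sq_integrable = square_dominated_integrable[OF _ V_integrable]

lemma dir_sq_integrable: "integrable M (dir_sq k)"
  unfolding dir_sq_def[abs_def]
  by (intro Bochner_Integration.integrable_sum Bochner_Integration.integrable_add square_dominated_dir[THEN sq_integrable])

text \<open>The passage from extended to real integrals, possible now that \<open>V k\<close> is
  integrable; \<open>C\<close> is finite, so \<open>enn2real\<close> loses nothing.\<close>

lemma square_dominated_set_integral:
  assumes "square_dominated u"
  shows "\<exists>C\<ge>0. \<forall>k. \<forall>B\<in>sets (past k).
    (LINT \<omega>:B|M. (norm (u k \<omega>))\<^sup>2) \<le> C * ((LINT \<omega>:B|M. V k \<omega>) + measure M B)"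
proof -
  obtain C where C: "C < \<top>" and "\<And>k. u k \<in> borel_measurable M"
    and u: "\<And>k B. B \<in> sets (past k) \<Longrightarrow> (\<integral>\<^sup>+\<omega>\<in>B. ennreal ((norm (u k \<omega>))\<^sup>2) \<partial>M)
      \<le> C * (\<integral>\<^sup>+\<omega>\<in>B. ennreal (1 + V k \<omega>) \<partial>M)"
    by (rule square_dominatedE[OF assms]) (rule that)
  show ?thesis
  proof (intro exI[of _ "enn2real C"] conjI allI ballI)
    fix k B assume B: "B \<in> sets (past k)"
    then have BM: "B \<in> sets M" by (rule past_sets)
    have split: "(LINT \<omega>:B|M. 1 + V k \<omega>) = measure M B + (LINT \<omega>:B|M. V k \<omega>)"
    proof -
      have "(LINT \<omega>:B|M. 1 + V k \<omega>) = (LINT \<omega>:B|M. 1) + (LINT \<omega>:B|M. V k \<omega>)"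
        by (intro set_integral_add(2); unfold set_integrable_def; intro integrable_mult_indicator BM V_integrable integrable_const)
      then show ?thesis using BM by (simp add: set_integral_const emeasure_eq_measure)
    qed
    have V0: "0 \<le> (LINT \<omega>:B|M. 1 + V k \<omega>)"
      unfolding set_lebesgue_integral_def by (intro Bochner_Integration.integral_nonneg) (simp add: V_nonneg)
    have "ennreal (LINT \<omega>:B|M. (norm (u k \<omega>))\<^sup>2) = (\<integral>\<^sup>+\<omega>\<in>B. ennreal ((norm (u k \<omega>))\<^sup>2) \<partial>M)"
      by (rule set_nn_integral_eq_set_integral[symmetric, OF BM sq_integrable[OF assms]]) simp
    also have "\<dots> \<le> ennreal (enn2real C) * (\<integral>\<^sup>+\<omega>\<in>B. ennreal (1 + V k \<omega>) \<partial>M)"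
      using u[OF B] C by simp
    also have "(\<integral>\<^sup>+\<omega>\<in>B. ennreal (1 + V k \<omega>) \<partial>M) = ennreal (LINT \<omega>:B|M. 1 + V k \<omega>)"
      by (rule set_nn_integral_eq_set_integral[OF BM]) (auto simp: V_nonneg V_integrable)
    also have "ennreal (enn2real C) * \<dots> = ennreal (enn2real C * (LINT \<omega>:B|M. 1 + V k \<omega>))"
      using V0 by (simp add: ennreal_mult)
    finally show "(LINT \<omega>:B|M. (norm (u k \<omega>))\<^sup>2) \<le> enn2real C * ((LINT \<omega>:B|M. V k \<omega>) + measure M B)"
      using V0 split by (subst (asm) ennreal_le_iff) (auto simp: add.commute)
  qed simp
qed

lemma dir_sq_set_integral:
  "\<exists>C\<ge>0. \<forall>k. \<forall>B\<in>sets (past k). (LINT \<omega>:B|M. dir_sq k \<omega>) \<le> C * ((LINT \<omega>:B|M. V k \<omega>) + measure M B)"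
proof -
  obtain Cp where Cp: "\<And>i. 0 \<le> Cp i" "\<And>i k B. B \<in> sets (past k) \<Longrightarrow>
      (LINT \<omega>:B|M. (norm (primal_dir k i \<omega>))\<^sup>2) \<le> Cp i * ((LINT \<omega>:B|M. V k \<omega>) + measure M B)"
    using square_dominated_dir(2)[THEN square_dominated_set_integral] by metis
  obtain Cd where Cd: "\<And>i. 0 \<le> Cd i" "\<And>i k B. B \<in> sets (past k) \<Longrightarrow>
      (LINT \<omega>:B|M. (norm (dual_dir k i \<omega>))\<^sup>2) \<le> Cd i * ((LINT \<omega>:B|M. V k \<omega>) + measure M B)"
    using square_dominated_dir(1)[THEN square_dominated_set_integral] by metis
  show ?thesis
  proof (intro exI[of _ "\<Sum>i\<in>UNIV. Cp i + Cd i"] conjI allI ballI)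
    fix k B assume B: "B \<in> sets (past k)"
    then have BM: "B \<in> sets M" by (rule past_sets)
    have "(LINT \<omega>:B|M. dir_sq k \<omega>)
        = (\<Sum>i\<in>UNIV. (LINT \<omega>:B|M. (norm (primal_dir k i \<omega>))\<^sup>2) + (LINT \<omega>:B|M. (norm (dual_dir k i \<omega>))\<^sup>2))"
      unfolding set_lebesgue_integral_def dir_sq_def scaleR_sum_right scaleR_add_right
      by (subst Bochner_Integration.integral_sum;
          (subst Bochner_Integration.integral_add)?;
          intro Bochner_Integration.integrable_add integrable_mult_indicator BM square_dominated_dir[THEN sq_integrable] refl)
    also have "\<dots> \<le> (\<Sum>i\<in>UNIV. (Cp i + Cd i) * ((LINT \<omega>:B|M. V k \<omega>) + measure M B))"
      by (intro sum_mono) (simp add: distrib_right add_mono Cp(2)[OF B] Cd(2)[OF B])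
    finally show "(LINT \<omega>:B|M. dir_sq k \<omega>) \<le> (\<Sum>i\<in>UNIV. Cp i + Cd i) * ((LINT \<omega>:B|M. V k \<omega>) + measure M B)"
      by (simp add: sum_distrib_right)
  qed (simp add: sum_nonneg Cp(1) Cd(1))
qed

section \<open>Averaging the drift over graph and noise\<close>

definition mean_drift :: "nat \<Rightarrow> 'b \<Rightarrow> real" where
  "mean_drift k \<omega> = (\<Sum>i\<in>UNIV.
     (x k i \<omega> - Xs i) \<bullet> (g i (x k i \<omega>) + disagreement Abar (\<lambda>j. lam k j \<omega>) i + disagreement Abar (\<lambda>j. x k j \<omega>) i)
     - (lam k i \<omega> - \<Lambda>s i) \<bullet> disagreement Abar (\<lambda>j. x k j \<omega>) i)"

text \<open>Stated from time 1 on, where the projection has placed the iterates in the sets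
  \<open>\<Omega> i\<close>.\<close>

lemma mean_drift_nonneg:
  assumes "\<omega> \<in> space M"
  shows "0 \<le> mean_drift (Suc k) \<omega>"
  unfolding mean_drift_def
  by (rule saddle_drift_nonneg[OF f_convex f_grad Abar_sym Abar_nonneg saddle[unfolded mean_laplacian]])
    (simp_all add: x_in assms)

lemma noise_sq_integrable:
  fixes w :: "'b \<Rightarrow> 'a"
  assumes [measurable]: "w \<in> borel_measurable M"
    and "AE \<omega> in M. nn_cond_exp M (past_graph k) (\<lambda>\<omega>. ennreal ((norm (w \<omega>))\<^sup>2)) \<omega> \<le> ennreal (\<mu>\<^sup>2)"
  shows "integrable M (\<lambda>\<omega>. (norm (w \<omega>))\<^sup>2)"
proof -
  have "(\<integral>\<^sup>+\<omega>. 1 * ennreal ((norm (w \<omega>))\<^sup>2) \<partial>M) \<le> (\<integral>\<^sup>+\<omega>. 1 * ennreal (\<mu>\<^sup>2) \<partial>M)"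
    by (rule nn_integral_cond_bound) (use assms in measurable)
  then have "(\<integral>\<^sup>+\<omega>. ennreal ((norm (w \<omega>))\<^sup>2) \<partial>M) \<le> ennreal (\<mu>\<^sup>2)"
    by (simp add: emeasure_space_1)
  also have "\<dots> < \<infinity>" by simp
  finally show ?thesis by (intro integrableI_bounded) auto
qed

lemma noise_inner_integral:
  fixes u w :: "'b \<Rightarrow> 'a"
  assumes "u \<in> borel_measurable (past_graph k)" "w \<in> borel_measurable M"
    and "integrable M (\<lambda>\<omega>. (norm (u \<omega>))\<^sup>2)" "integrable M (\<lambda>\<omega>. (norm (w \<omega>))\<^sup>2)"
    and "\<And>b. b \<in> Basis \<Longrightarrow> AE \<omega> in M. real_cond_exp M (past_graph k) (\<lambda>\<omega>. w \<omega> \<bullet> b) \<omega> = 0"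
  shows "has_bochner_integral M (\<lambda>\<omega>. u \<omega> \<bullet> w \<omega>) 0"
proof -
  interpret P: sigma_finite_subalgebra M "past_graph k" by (rule sigma_finite_past_graph)
  show ?thesis
    using P.integral_inner_cond_mean_zero[OF assms] by (simp add: has_bochner_integral_iff)
qed

text \<open>Two integrals with the same value: over sets of the past, a noisy randomly weighted term
  may be exchanged for its noiseless version with weight \<open>Abar $ i $ j\<close>. The signal
  part uses independence of the weight, the noise part conditional centring.\<close>

lemma entry_inner_integral:
  fixes u z w :: "'b \<Rightarrow> 'a"
  assumes B: "B \<in> sets (past k)"
    and u: "u \<in> borel_measurable (past k)" "integrable M (\<lambda>\<omega>. (norm (u \<omega>))\<^sup>2)"
    and z: "z \<in> borel_measurable (past k)" "integrable M (\<lambda>\<omega>. (norm (z \<omega>))\<^sup>2)"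
    and w: "w \<in> borel_measurable M"
      "AE \<omega> in M. nn_cond_exp M (past_graph k) (\<lambda>\<omega>. ennreal ((norm (w \<omega>))\<^sup>2)) \<omega> \<le> ennreal (\<mu>\<^sup>2)"
      "\<And>b. b \<in> Basis \<Longrightarrow> AE \<omega> in M. real_cond_exp M (past_graph k) (\<lambda>\<omega>. w \<omega> \<bullet> b) \<omega> = 0"
  shows "has_bochner_integral M (\<lambda>\<omega>. indicator B \<omega> * (u \<omega> \<bullet> (A k \<omega> $ i $ j *\<^sub>R (z \<omega> - w \<omega>))))
      (Abar $ i $ j * (LINT \<omega>:B|M. u \<omega> \<bullet> z \<omega>))"
    and "has_bochner_integral M (\<lambda>\<omega>. indicator B \<omega> * (u \<omega> \<bullet> (Abar $ i $ j *\<^sub>R z \<omega>)))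
      (Abar $ i $ j * (LINT \<omega>:B|M. u \<omega> \<bullet> z \<omega>))"
proof -
  note [measurable] = B u(1) z(1) w(1)
  have BM: "B \<in> sets M" and [measurable]: "B \<in> sets (past_graph k)"
    using past_sets[OF B] past_sets_graph[OF B] .
  have uM: "u \<in> borel_measurable M" and zM: "z \<in> borel_measurable M"
    by (rule measurable_from_subalg[OF subalgebra_info u(1)], rule measurable_from_subalg[OF subalgebra_info z(1)])
  have [measurable]: "u \<in> borel_measurable (past_graph k)"
    by (rule measurable_from_subalg[OF past_graph_subalgebra u(1)])
  have [measurable]: "A k \<in> borel_measurable (past_graph k)" by (simp add: measurable_info_sigma)
  have uz: "integrable M (\<lambda>\<omega>. indicator B \<omega> * (u \<omega> \<bullet> z \<omega>))"
    using integrable_mult_indicator[OF BM integrable_inner_of_squares[OF uM zM u(2) z(2)]] by simp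
  have int_eq: "(LINT \<omega>:B|M. u \<omega> \<bullet> z \<omega>) = (\<integral>\<omega>. indicator B \<omega> * (u \<omega> \<bullet> z \<omega>) \<partial>M)"
    by (simp add: set_lebesgue_integral_def)
  show "has_bochner_integral M (\<lambda>\<omega>. indicator B \<omega> * (u \<omega> \<bullet> (Abar $ i $ j *\<^sub>R z \<omega>)))
      (Abar $ i $ j * (LINT \<omega>:B|M. u \<omega> \<bullet> z \<omega>))"
    using has_bochner_integral_mult_right[OF has_bochner_integral_integrable[OF uz], of "Abar $ i $ j"]
    by (simp add: int_eq mult.left_commute)
  have signal: "has_bochner_integral M (\<lambda>\<omega>. A k \<omega> $ i $ j * (indicator B \<omega> * (u \<omega> \<bullet> z \<omega>)))
      (Abar $ i $ j * (LINT \<omega>:B|M. u \<omega> \<bullet> z \<omega>))"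
    unfolding int_eq by (rule entry_times_integral[OF _ uz]) measurable
  \<comment> \<open>The weight and the test set join the factor known in
    \<open>past_graph k\<close>, against which \<open>w\<close> is centred. Independence of the
    weight from \<open>u\<close> keeps \<open>q\<close> square integrable.\<close>
  define q where "q \<omega> = (indicator B \<omega> * A k \<omega> $ i $ j) *\<^sub>R u \<omega>" for \<omega>
  have q [measurable]: "q \<in> borel_measurable (past_graph k)"
    unfolding q_def[abs_def] by measurable
  then have qM [measurable]: "q \<in> borel_measurable M"
    by (rule measurable_from_subalg[OF subalgebra_info])
  have "(\<integral>\<^sup>+\<omega>. ennreal ((norm (q \<omega>))\<^sup>2) \<partial>M) \<le> (\<integral>\<^sup>+\<omega>. ennreal ((A k \<omega> $ i $ j)\<^sup>2) * ennreal ((norm (u \<omega>))\<^sup>2) \<partial>M)"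
    by (rule nn_integral_mono)
      (simp add: q_def power_mult_distrib ennreal_mult split: split_indicator)
  also have "\<dots> \<le> ennreal (\<eta>\<^sup>2) * (\<integral>\<^sup>+\<omega>. ennreal ((norm (u \<omega>))\<^sup>2) \<partial>M)"
    by (rule nn_integral_entry_sq) measurable
  also have "\<dots> < \<infinity>"
    using u(2) by (simp add: nn_integral_eq_integral ennreal_mult_less_top)
  finally have q2: "integrable M (\<lambda>\<omega>. (norm (q \<omega>))\<^sup>2)"
    by (intro integrableI_bounded) auto
  have "has_bochner_integral M (\<lambda>\<omega>. q \<omega> \<bullet> w \<omega>) 0"
    by (rule noise_inner_integral[OF q w(1) q2 noise_sq_integrable[OF w(1,2)] w(3)])
  from has_bochner_integral_diff[OF signal this]
  show "has_bochner_integral M (\<lambda>\<omega>. indicator B \<omega> * (u \<omega> \<bullet> (A k \<omega> $ i $ j *\<^sub>R (z \<omega> - w \<omega>))))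
      (Abar $ i $ j * (LINT \<omega>:B|M. u \<omega> \<bullet> z \<omega>))"
    by (simp add: q_def inner_diff_right right_diff_distrib mult.left_commute mult.assoc)
qed

text \<open>Says that \<open>mean_drift k\<close> averages \<open>drift k\<close> given the past.
  Both integrals are computed term by term and found to have the same value
  \<open>?c\<close>.\<close>

lemma drift_set_integral:
  assumes B: "B \<in> sets (past k)"
  shows "integrable M (drift k)" "(LINT \<omega>:B|M. drift k \<omega>) = (LINT \<omega>:B|M. mean_drift k \<omega>)"
proof -
  show "integrable M (drift k)"
    unfolding drift_def[abs_def]
    by (intro Bochner_Integration.integrable_sum Bochner_Integration.integrable_diff
        integrable_inner_of_squares square_dominated_deviation[THEN sq_integrable] square_dominated_dir[THEN sq_integrable]
        borel_measurable_diff borel_measurable_const measurable_M dir_measurable)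
  have BM [measurable]: "B \<in> sets M" and [measurable]: "B \<in> sets (past_graph k)"
    using past_sets[OF B] past_sets_graph[OF B] .
  let ?dx = "\<lambda>i \<omega>. x k i \<omega> - Xs i" and ?dl = "\<lambda>i \<omega>. lam k i \<omega> - \<Lambda>s i"
  let ?ind = "indicator B :: 'b \<Rightarrow> real"
  have dx: "?dx i \<in> borel_measurable (past k)" "integrable M (\<lambda>\<omega>. (norm (?dx i \<omega>))\<^sup>2)"
    and dl: "?dl i \<in> borel_measurable (past k)" "integrable M (\<lambda>\<omega>. (norm (?dl i \<omega>))\<^sup>2)"
    and xx: "(\<lambda>\<omega>. x k i \<omega> - x k j \<omega>) \<in> borel_measurable (past k)" "integrable M (\<lambda>\<omega>. (norm (x k i \<omega> - x k j \<omega>))\<^sup>2)"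
    and ll: "(\<lambda>\<omega>. lam k i \<omega> - lam k j \<omega>) \<in> borel_measurable (past k)" "integrable M (\<lambda>\<omega>. (norm (lam k i \<omega> - lam k j \<omega>))\<^sup>2)" for i j
    by (intro borel_measurable_diff borel_measurable_const adapted
        square_dominated_deviation[THEN sq_integrable] square_dominated_diff[THEN sq_integrable] square_dominated_state)+
  note ex = entry_inner_integral[OF B dx xx wx_meas wx_var wx_mean]
    and el = entry_inner_integral[OF B dx ll wl_meas wl_var wl_mean]
    and ed = entry_inner_integral[OF B dl xx wx_meas wx_var wx_mean]
  have "integrable M (\<lambda>\<omega>. ?dx i \<omega> \<bullet> g i (x k i \<omega>))" for i
    by (intro integrable_inner_of_squares square_dominated_deviation[THEN sq_integrable]
        square_dominated_gradient[THEN sq_integrable] borel_measurable_diff borel_measurable_const measurable_M)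
  then have "integrable M (\<lambda>\<omega>. ?ind \<omega> *\<^sub>R (?dx i \<omega> \<bullet> g i (x k i \<omega>)))" for i
    by (rule integrable_mult_indicator[OF BM])
  then have eg: "has_bochner_integral M (\<lambda>\<omega>. ?ind \<omega> * (?dx i \<omega> \<bullet> g i (x k i \<omega>))) (LINT \<omega>:B|M. ?dx i \<omega> \<bullet> g i (x k i \<omega>))" for i
    unfolding set_lebesgue_integral_def real_scaleR_def by (rule has_bochner_integral_integrable)
  have ev: "has_bochner_integral M (\<lambda>\<omega>. ?ind \<omega> * (?dx i \<omega> \<bullet> v k i \<omega>)) 0" for i
  proof -
    have [measurable]: "?dx i \<in> borel_measurable (past_graph k)"
      by (rule measurable_from_subalg[OF past_graph_subalgebra dx(1)])
    \<comment> \<open>The indicator is absorbed into the known factor, which stays square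
      integrable, so the rule for centred noise applies.\<close>
    have "integrable M (\<lambda>\<omega>. ?ind \<omega> *\<^sub>R (norm (?dx i \<omega>))\<^sup>2)"
      by (rule integrable_mult_indicator[OF BM dx(2)])
    then have "integrable M (\<lambda>\<omega>. (norm (?ind \<omega> *\<^sub>R ?dx i \<omega>))\<^sup>2)"
      by (rule back_subst[of "integrable M"]) (auto simp: fun_eq_iff split: split_indicator)
    from noise_inner_integral[OF _ v_meas this square_dominated_v[THEN sq_integrable] v_mean, of k]
    show ?thesis by simp
  qed
  \<comment> \<open>The summand 0 is the contribution of the gradient noise \<open>v\<close>; it is
    kept so that both sums are assembled in the same shape.\<close>
  let ?c = "\<Sum>i\<in>UNIV. (LINT \<omega>:B|M. ?dx i \<omega> \<bullet> g i (x k i \<omega>)) + 0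
    + (\<Sum>j\<in>UNIV. Abar $ i $ j * (LINT \<omega>:B|M. ?dx i \<omega> \<bullet> (lam k i \<omega> - lam k j \<omega>)))
    + (\<Sum>j\<in>UNIV. Abar $ i $ j * (LINT \<omega>:B|M. ?dx i \<omega> \<bullet> (x k i \<omega> - x k j \<omega>)))
    - (\<Sum>j\<in>UNIV. Abar $ i $ j * (LINT \<omega>:B|M. ?dl i \<omega> \<bullet> (x k i \<omega> - x k j \<omega>)))"
  have "has_bochner_integral M (\<lambda>\<omega>. \<Sum>i\<in>UNIV. ?ind \<omega> * (?dx i \<omega> \<bullet> g i (x k i \<omega>)) + ?ind \<omega> * (?dx i \<omega> \<bullet> v k i \<omega>)
    + (\<Sum>j\<in>UNIV. ?ind \<omega> * (?dx i \<omega> \<bullet> (A k \<omega> $ i $ j *\<^sub>R (lam k i \<omega> - lam k j \<omega> - wl k i j \<omega>))))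
    + (\<Sum>j\<in>UNIV. ?ind \<omega> * (?dx i \<omega> \<bullet> (A k \<omega> $ i $ j *\<^sub>R (x k i \<omega> - x k j \<omega> - wx k i j \<omega>))))
    - (\<Sum>j\<in>UNIV. ?ind \<omega> * (?dl i \<omega> \<bullet> (A k \<omega> $ i $ j *\<^sub>R (x k i \<omega> - x k j \<omega> - wx k i j \<omega>))))) ?c"
    by (intro has_bochner_integral_sum has_bochner_integral_diff has_bochner_integral_add eg ev ex(1) el(1) ed(1))
  moreover have "(\<lambda>\<omega>. \<Sum>i\<in>UNIV. ?ind \<omega> * (?dx i \<omega> \<bullet> g i (x k i \<omega>)) + ?ind \<omega> * (?dx i \<omega> \<bullet> v k i \<omega>)
    + (\<Sum>j\<in>UNIV. ?ind \<omega> * (?dx i \<omega> \<bullet> (A k \<omega> $ i $ j *\<^sub>R (lam k i \<omega> - lam k j \<omega> - wl k i j \<omega>))))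
    + (\<Sum>j\<in>UNIV. ?ind \<omega> * (?dx i \<omega> \<bullet> (A k \<omega> $ i $ j *\<^sub>R (x k i \<omega> - x k j \<omega> - wx k i j \<omega>))))
    - (\<Sum>j\<in>UNIV. ?ind \<omega> * (?dl i \<omega> \<bullet> (A k \<omega> $ i $ j *\<^sub>R (x k i \<omega> - x k j \<omega> - wx k i j \<omega>)))))
    = (\<lambda>\<omega>. ?ind \<omega> *\<^sub>R drift k \<omega>)"
    unfolding drift_def primal_dir_def dual_dir_def inner_add_right inner_sum_right real_scaleR_def
      sum_distrib_left distrib_left right_diff_distrib by (rule refl)
  ultimately have 1: "has_bochner_integral M (\<lambda>\<omega>. ?ind \<omega> *\<^sub>R drift k \<omega>) ?c" by simp
  have "has_bochner_integral M (\<lambda>\<omega>. \<Sum>i\<in>UNIV. ?ind \<omega> * (?dx i \<omega> \<bullet> g i (x k i \<omega>)) + 0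
    + (\<Sum>j\<in>UNIV. ?ind \<omega> * (?dx i \<omega> \<bullet> (Abar $ i $ j *\<^sub>R (lam k i \<omega> - lam k j \<omega>))))
    + (\<Sum>j\<in>UNIV. ?ind \<omega> * (?dx i \<omega> \<bullet> (Abar $ i $ j *\<^sub>R (x k i \<omega> - x k j \<omega>))))
    - (\<Sum>j\<in>UNIV. ?ind \<omega> * (?dl i \<omega> \<bullet> (Abar $ i $ j *\<^sub>R (x k i \<omega> - x k j \<omega>))))) ?c"
    by (intro has_bochner_integral_sum has_bochner_integral_diff has_bochner_integral_add
        has_bochner_integral_zero eg ex(2) el(2) ed(2))
  moreover have "(\<lambda>\<omega>. \<Sum>i\<in>UNIV. ?ind \<omega> * (?dx i \<omega> \<bullet> g i (x k i \<omega>)) + 0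
    + (\<Sum>j\<in>UNIV. ?ind \<omega> * (?dx i \<omega> \<bullet> (Abar $ i $ j *\<^sub>R (lam k i \<omega> - lam k j \<omega>))))
    + (\<Sum>j\<in>UNIV. ?ind \<omega> * (?dx i \<omega> \<bullet> (Abar $ i $ j *\<^sub>R (x k i \<omega> - x k j \<omega>))))
    - (\<Sum>j\<in>UNIV. ?ind \<omega> * (?dl i \<omega> \<bullet> (Abar $ i $ j *\<^sub>R (x k i \<omega> - x k j \<omega>)))))
    = (\<lambda>\<omega>. ?ind \<omega> *\<^sub>R mean_drift k \<omega>)"
    unfolding mean_drift_def inner_add_right inner_sum_right real_scaleR_def
      sum_distrib_left distrib_left right_diff_distrib add_0_right by (rule refl)
  ultimately have 2: "has_bochner_integral M (\<lambda>\<omega>. ?ind \<omega> *\<^sub>R mean_drift k \<omega>) ?c" by simp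
  from 1 2 show "(LINT \<omega>:B|M. drift k \<omega>) = (LINT \<omega>:B|M. mean_drift k \<omega>)"
    unfolding set_lebesgue_integral_def by (simp only: has_bochner_integral_integral_eq)
qed

section \<open>The almost supermartingale inequality and convergence\<close>

lemma V_almost_supermartingale:
  "\<exists>C\<ge>0. \<forall>k\<ge>1. \<forall>B\<in>sets (past k). (LINT \<omega>:B|M. V (Suc k) \<omega>)
    \<le> (1 + C * (\<gamma> k)\<^sup>2) * (LINT \<omega>:B|M. V k \<omega>) + C * (\<gamma> k)\<^sup>2 * measure M B"
proof -
  obtain C where C: "0 \<le> C" and dir: "\<And>k B. B \<in> sets (past k) \<Longrightarrow>
      (LINT \<omega>:B|M. dir_sq k \<omega>) \<le> C * ((LINT \<omega>:B|M. V k \<omega>) + measure M B)"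
    using dir_sq_set_integral by metis
  show ?thesis
  proof (intro exI[of _ C] conjI C allI impI ballI)
    fix k B assume k: "1 \<le> k" and B: "B \<in> sets (past k)"
    have BM: "B \<in> sets M" by (rule past_sets[OF B])
    \<comment> \<open>Exhibits \<open>k\<close> as a successor, as the sign of the mean drift
      requires.\<close>
    obtain l where l: "k = Suc l" using k by (cases k) auto
    have setI: "set_integrable M B h" if "integrable M h" for h :: "'b \<Rightarrow> real"
      unfolding set_integrable_def by (intro integrable_mult_indicator BM that)
    note ints = setI[OF V_integrable] setI[OF drift_set_integral(1)[OF B]] setI[OF dir_sq_integrable]
    have "(LINT \<omega>:B|M. V (Suc k) \<omega>) \<le> (LINT \<omega>:B|M. V k \<omega> - 2 * \<gamma> k * drift k \<omega> + (\<gamma> k)\<^sup>2 * dir_sq k \<omega>)"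
      using BM sets.sets_into_space[OF BM]
      by (intro set_integral_mono set_integral_add set_integral_diff set_integrable_mult_right ints V_Suc_le) auto
    also have "\<dots> = (LINT \<omega>:B|M. V k \<omega>) - 2 * \<gamma> k * (LINT \<omega>:B|M. drift k \<omega>) + (\<gamma> k)\<^sup>2 * (LINT \<omega>:B|M. dir_sq k \<omega>)"
      using ints by (simp add: set_integral_add set_integral_diff)
    also have "\<dots> \<le> (LINT \<omega>:B|M. V k \<omega>) + (\<gamma> k)\<^sup>2 * (C * ((LINT \<omega>:B|M. V k \<omega>) + measure M B))"
    proof -
      have "0 \<le> (LINT \<omega>:B|M. mean_drift k \<omega>)"
        unfolding set_lebesgue_integral_def l
        by (intro integral_nonneg_AE AE_I2) (simp add: mean_drift_nonneg)
      then have "0 \<le> \<gamma> k * (LINT \<omega>:B|M. drift k \<omega>)"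
        by (simp add: drift_set_integral(2)[OF B] \<gamma>_nonneg)
      moreover have "(\<gamma> k)\<^sup>2 * (LINT \<omega>:B|M. dir_sq k \<omega>) \<le> (\<gamma> k)\<^sup>2 * (C * ((LINT \<omega>:B|M. V k \<omega>) + measure M B))"
        by (intro mult_left_mono dir B) simp
      ultimately show ?thesis by simp
    qed
    finally show "(LINT \<omega>:B|M. V (Suc k) \<omega>)
        \<le> (1 + C * (\<gamma> k)\<^sup>2) * (LINT \<omega>:B|M. V k \<omega>) + C * (\<gamma> k)\<^sup>2 * measure M B"
      by (simp add: algebra_simps)
  qed
qed

lemma V_convergent: "AE \<omega> in M. convergent (\<lambda>k. V k \<omega>)"
proof -
  \<comment> \<open>The process is started at time 1: \<open>x0 i\<close> may lie outside \<open>\<Omega> i\<close>, where \<open>g i\<close> is arbitrary.\<close>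
  obtain C where C: "0 \<le> C" and V: "\<And>k B. 1 \<le> k \<Longrightarrow> B \<in> sets (past k) \<Longrightarrow> (LINT \<omega>:B|M. V (Suc k) \<omega>)
    \<le> (1 + C * (\<gamma> k)\<^sup>2) * (LINT \<omega>:B|M. V k \<omega>) + C * (\<gamma> k)\<^sup>2 * measure M B"
    using V_almost_supermartingale by metis
  have sum: "summable (\<lambda>k. (\<gamma> (Suc k))\<^sup>2)"
    using \<gamma>_sq by (simp add: summable_Suc_iff[where f = "\<lambda>k. (\<gamma> k)\<^sup>2"])
  have "AE \<omega> in M. convergent (\<lambda>k. V (Suc k) \<omega>)"
    by (rule almost_supermartingale_convergent[where F = "\<lambda>k. past (Suc k)" and V = "\<lambda>k. V (Suc k)"
        and c = "\<lambda>k. C * (\<gamma> (Suc k))\<^sup>2" and d = "\<lambda>k. C * (\<gamma> (Suc k))\<^sup>2"])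
      (simp_all add: subalgebra_info past_subalgebra V_adapted V_integrable V_nonneg C sum V)
  then show ?thesis
    by eventually_elim (simp add: convergent_Suc_iff[where f = "\<lambda>k. V k _"])
qed

end

theorem theorem1:
  fixes M :: "'b measure"
    and \<Omega> :: "'n::finite \<Rightarrow> 'a::euclidean_space set"
    and f :: "'n \<Rightarrow> 'a \<Rightarrow> real"
    and g :: "'n \<Rightarrow> 'a \<Rightarrow> 'a"
    and A :: "nat \<Rightarrow> 'b \<Rightarrow> real^'n^'n"
    and wx wl :: "nat \<Rightarrow> 'n \<Rightarrow> 'n \<Rightarrow> 'b \<Rightarrow> 'a"
    and v :: "nat \<Rightarrow> 'n \<Rightarrow> 'b \<Rightarrow> 'a"
    and \<gamma> :: "nat \<Rightarrow> real"
    and x0 l0 :: "'n \<Rightarrow> 'a"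
    and x lam :: "nat \<Rightarrow> 'n \<Rightarrow> 'b \<Rightarrow> 'a"
    and Lf \<eta> \<mu> cv :: real
    and Xs \<Lambda>s :: "'n \<Rightarrow> 'a"
  assumes prob: "prob_space M"
    \<comment> \<open>standing assumptions on the problem\<close>
    and closed: "\<And>i. closed (\<Omega> i)" and convex: "\<And>i. convex (\<Omega> i)" and nonempty: "\<And>i. \<Omega> i \<noteq> {}"
    and f_convex: "\<And>i. convex_on (\<Omega> i) (f i)"
    and f_grad: "\<And>i y. y \<in> \<Omega> i \<Longrightarrow> (f i has_derivative (\<lambda>h. g i y \<bullet> h)) (at y)"
    and solvable: "\<exists>y\<in>(\<Inter>i. \<Omega> i). \<forall>z\<in>(\<Inter>i. \<Omega> i). (\<Sum>i\<in>UNIV. f i y) \<le> (\<Sum>i\<in>UNIV. f i z)"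
    \<comment> \<open>random graphs\<close>
    and A_meas: "\<And>k. A k \<in> borel_measurable M"
    and A_nonneg: "\<And>k i j \<omega>. \<omega> \<in> space M \<Longrightarrow> A k \<omega> $ i $ j \<ge> 0"
    and A_diag: "\<And>k i \<omega>. \<omega> \<in> space M \<Longrightarrow> A k \<omega> $ i $ i = 0"
    \<comment> \<open>noises are random variables\<close>
    and wx_meas: "\<And>k i j. wx k i j \<in> borel_measurable M"
    and wl_meas: "\<And>k i j. wl k i j \<in> borel_measurable M"
    and v_meas: "\<And>k i. v k i \<in> borel_measurable M"
    \<comment> \<open>the algorithm\<close>
    and x_init: "\<And>i \<omega>. \<omega> \<in> space M \<Longrightarrow> x 0 i \<omega> = x0 i"
    and lam_init: "\<And>i \<omega>. \<omega> \<in> space M \<Longrightarrow> lam 0 i \<omega> = l0 i"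
    and x_step: "\<And>k i \<omega>. \<omega> \<in> space M \<Longrightarrow> x (Suc k) i \<omega> = closest_point (\<Omega> i)
        (x k i \<omega> - \<gamma> k *\<^sub>R (g i (x k i \<omega>) + v k i \<omega>)
          - \<gamma> k *\<^sub>R (\<Sum>j\<in>{j. A k \<omega> $ i $ j > 0}. A k \<omega> $ i $ j *\<^sub>R (lam k i \<omega> - (lam k j \<omega> + wl k i j \<omega>)))
          - \<gamma> k *\<^sub>R (\<Sum>j\<in>{j. A k \<omega> $ i $ j > 0}. A k \<omega> $ i $ j *\<^sub>R (x k i \<omega> - (x k j \<omega> + wx k i j \<omega>))))"
    and lam_step: "\<And>k i \<omega>. \<omega> \<in> space M \<Longrightarrow> lam (Suc k) i \<omega> = lam k i \<omega>
          + \<gamma> k *\<^sub>R (\<Sum>j\<in>{j. A k \<omega> $ i $ j > 0}. A k \<omega> $ i $ j *\<^sub>R (x k i \<omega> - (x k j \<omega> + wx k i j \<omega>)))"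
    \<comment> \<open>(i) relative interior point\<close>
    and relint: "rel_interior (\<Inter>i. \<Omega> i) \<noteq> {}"
    \<comment> \<open>(ii) Lipschitz gradients\<close>
    and Lf_pos: "Lf > 0"
    and lipschitz: "\<And>i y z. y \<in> \<Omega> i \<Longrightarrow> z \<in> \<Omega> i \<Longrightarrow> norm (g i y - g i z) \<le> Lf * norm (y - z)"
    \<comment> \<open>(iii) i.i.d. graphs, symmetric connected mean graph, bounded second moments, independence\<close>
    and A_indep: "prob_space.indep_vars M (\<lambda>_. borel) A UNIV"
    and A_ident: "\<And>k. distr M borel (A k) = distr M borel (A 0)"
    and Abar_sym: "\<And>i j. mean_mat M (A 0) $ i $ j = mean_mat M (A 0) $ j $ i"
    and Abar_conn: "graph_connected (mean_mat M (A 0))"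
    and \<eta>_pos: "\<eta> > 0"
    and A_second: "\<And>k i j. (\<integral>\<^sup>+ \<omega>. ennreal ((A k \<omega> $ i $ j)\<^sup>2) \<partial>M) \<le> ennreal (\<eta>\<^sup>2)"
    and L_indep: "\<And>k. k \<ge> 1 \<Longrightarrow> prob_space.indep_set M
        {A k -` B \<inter> space M | B. B \<in> sets borel}
        (sets (info_sigma M A wx wl v {..<k} {..<k}))"
    \<comment> \<open>(iv) noises, conditioned on F'_{k-1} = sigma(L_k, F_{k-1})\<close>
    and \<mu>_pos: "\<mu> > 0" and cv_pos: "cv > 0"
    and wx_int: "\<And>k i j b. b \<in> Basis \<Longrightarrow> integrable M (\<lambda>\<omega>. wx k i j \<omega> \<bullet> b)"
    and wx_mean: "\<And>k i j b. b \<in> Basis \<Longrightarrow> AE \<omega> in M.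
        real_cond_exp M (info_sigma M A wx wl v {..k} {..<k}) (\<lambda>\<omega>. wx k i j \<omega> \<bullet> b) \<omega> = 0"
    and wx_var: "\<And>k i j. AE \<omega> in M.
        nn_cond_exp M (info_sigma M A wx wl v {..k} {..<k}) (\<lambda>\<omega>. ennreal ((norm (wx k i j \<omega>))\<^sup>2)) \<omega>
          \<le> ennreal (\<mu>\<^sup>2)"
    and wl_int: "\<And>k i j b. b \<in> Basis \<Longrightarrow> integrable M (\<lambda>\<omega>. wl k i j \<omega> \<bullet> b)"
    and wl_mean: "\<And>k i j b. b \<in> Basis \<Longrightarrow> AE \<omega> in M.
        real_cond_exp M (info_sigma M A wx wl v {..k} {..<k}) (\<lambda>\<omega>. wl k i j \<omega> \<bullet> b) \<omega> = 0"
    and wl_var: "\<And>k i j. AE \<omega> in M.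
        nn_cond_exp M (info_sigma M A wx wl v {..k} {..<k}) (\<lambda>\<omega>. ennreal ((norm (wl k i j \<omega>))\<^sup>2)) \<omega>
          \<le> ennreal (\<mu>\<^sup>2)"
    and v_int: "\<And>k i b. b \<in> Basis \<Longrightarrow> integrable M (\<lambda>\<omega>. v k i \<omega> \<bullet> b)"
    and v_mean: "\<And>k i b. b \<in> Basis \<Longrightarrow> AE \<omega> in M.
        real_cond_exp M (info_sigma M A wx wl v {..k} {..<k}) (\<lambda>\<omega>. v k i \<omega> \<bullet> b) \<omega> = 0"
    and v_var: "\<And>k i. AE \<omega> in M.
        nn_cond_exp M (info_sigma M A wx wl v {..k} {..<k}) (\<lambda>\<omega>. ennreal ((norm (v k i \<omega>))\<^sup>2)) \<omega>
          \<le> ennreal (cv * (1 + (norm (x k i \<omega>))\<^sup>2))"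
    \<comment> \<open>(v) step sizes\<close>
    and \<gamma>_pos: "\<And>k. \<gamma> k > 0"
    and \<gamma>_div: "\<not> summable \<gamma>"
    and \<gamma>_sq: "summable (\<lambda>k. (\<gamma> k)\<^sup>2)"
    \<comment> \<open>saddle point of Phi with Lbar = E[L_k]\<close>
    and saddle: "saddle_point f (mean_mat M (\<lambda>\<omega>. laplacian (A 0 \<omega>))) \<Omega> Xs \<Lambda>s"
  shows "AE \<omega> in M. convergent (\<lambda>k. (\<Sum>i\<in>UNIV. (norm (x k i \<omega> - Xs i))\<^sup>2)
                                   + (\<Sum>i\<in>UNIV. (norm (lam k i \<omega> - \<Lambda>s i))\<^sup>2))"
proof -
  interpret prob_space M by (rule prob)
  interpret primal_dual M \<Omega> f g A wx wl v \<gamma> x0 l0 x lam Lf \<eta> \<mu> cv Xs \<Lambda>s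
    by unfold_locales (fact | rule less_imp_le, fact)+
  show ?thesis using V_convergent unfolding V_def .
qed

end
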